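(* Let $r$ be a positive integer with $r\le 2\lfloor k/2\rfloor\lfloor (n-k)/2\rfloor$. Then at every $Q\in\operatorname{Gr}(k,n)$, \[ \overline{\delta}_{2,r}=\frac{k(n-k)(n-2)}{8},\qquad \underline{\delta}_{2,r}=\frac{k(n-k)(n-2)}{8}-\frac r4. \]
   Context: Fix integers $1\le k\le n-1$. Let $\mathbb{S}^n$ be the space of real symmetric $n\times n$ matrices with inner product $\operatorname{tr}(X^{\mathsf T}Y)$. Define $\operatorname{Gr}(k,n)=\{Q\in\mathbb{S}^n: Q^2=I_n,\ \operatorname{tr}(Q)=2k-n\}$ with the induced Riemannian metric and Levi-Civita connection $\nabla$. Let $\mathrm{Rm}(X,Y,Z,W)=\langle\nabla_X\nabla_YZ-\nabla_Y\nabla_XZ-\nabla_{[X,Y]}Z,W\rangle$, sectional curvature $\kappa_Q(V)=\mathrm{Rm}_Q(X,Y,Y,X)$ for a 2-dimensional subspace $V\subseteq\mathbb{T}_Q\operatorname{Gr}(k,n)$ with orthonormal basis $X,Y$, $\mathrm{Ric}_Q(X,Y)=\sum_i\mathrm{Rm}_Q(X,E_i,E_i,Y)$ and $\mathrm{Scal}_Q=\sum_i\mathrm{Ric}_Q(E_i,E_i)$ for an orthonormal basis $(E_i)$ of $\mathbb{T}_Q$. Define $\overline{\delta}_{2,r}=\mathrm{Scal}_Q-\inf\sum_{j=1}^r\kappa_Q(V_j)$ and $\underline{\delta}_{2,r}=\mathrm{Scal}_Q-\sup\sum_{j=1}^r\kappa_Q(V_j)$, where the infimum/supremum range over all $r$-tuples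 of mutually orthogonal 2-dimensional subspaces $V_1,\dots,V_r\subseteq\mathbb{T}_Q\operatorname{Gr}(k,n)$. *)

theory Defs
  imports "HOL-Analysis.Analysis"
begin

text \<open>Matrices are elements of real^'n^'n; the library inner product on this type is
  the sum of entrywise products, i.e. tr(X^T Y).\<close>

definition Grass :: "nat \<Rightarrow> (real^'n^'n) set" where
  "Grass k = {Q. transpose Q = Q \<and> Q ** Q = mat 1 \<and>
                 trace Q = 2 * real k - real CARD('n)}"

fun iter_dderiv :: "'a::real_normed_vector list \<Rightarrow> ('a \<Rightarrow> 'b::real_normed_vector) \<Rightarrow> 'a \<Rightarrow> 'b" where
  "iter_dderiv [] f = f"
| "iter_dderiv (v # vs) f = (\<lambda>x. frechet_derivative (iter_dderiv vs f) (at x) v)"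

definition smooth_map :: "('a::real_normed_vector \<Rightarrow> 'b::real_normed_vector) \<Rightarrow> bool" where
  "smooth_map f \<longleftrightarrow> (\<forall>vs x. iter_dderiv vs f differentiable (at x))"

definition tangent_space :: "'a::euclidean_space set \<Rightarrow> 'a \<Rightarrow> 'a set" where
  "tangent_space M p = {v. \<exists>\<gamma>::real \<Rightarrow> 'a. \<gamma> 0 = p \<and> (\<forall>t. \<gamma> t \<in> M) \<and>
                              (\<gamma> has_vector_derivative v) (at 0)}"

definition tproj :: "'a::euclidean_space set \<Rightarrow> 'a \<Rightarrow> 'a \<Rightarrow> 'a" where
  "tproj M p v = closest_point (tangent_space M p) v"

definition dir_deriv :: "'a::euclidean_space set \<Rightarrow> ('a \<Rightarrow> 'b::real_normed_vector) \<Rightarrow> 'a \<Rightarrow> 'a \<Rightarrow> 'b" where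
  "dir_deriv M f p v = (SOME w. \<exists>f'. (f has_derivative f') (at p within M) \<and> f' v = w)"

definition tangent_field :: "'a::euclidean_space set \<Rightarrow> ('a \<Rightarrow> 'a) \<Rightarrow> bool" where
  "tangent_field M X \<longleftrightarrow> smooth_map X \<and> (\<forall>p\<in>M. X p \<in> tangent_space M p)"

text \<open>Levi-Civita connection of the induced metric: tangential projection of the
  ambient derivative; Lie bracket of vector fields; curvature operator.\<close>
definition conn :: "'a::euclidean_space set \<Rightarrow> ('a \<Rightarrow> 'a) \<Rightarrow> ('a \<Rightarrow> 'a) \<Rightarrow> 'a \<Rightarrow> 'a" where
  "conn M X Y p = tproj M p (dir_deriv M Y p (X p))"

definition lie_bracket :: "'a::euclidean_space set \<Rightarrow> ('a \<Rightarrow> 'a) \<Rightarrow> ('a \<Rightarrow> 'a) \<Rightarrow> 'a \<Rightarrow> 'a" where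
  "lie_bracket M X Y p = dir_deriv M Y p (X p) - dir_deriv M X p (Y p)"

definition curv_field :: "'a::euclidean_space set \<Rightarrow> ('a \<Rightarrow> 'a) \<Rightarrow> ('a \<Rightarrow> 'a) \<Rightarrow> ('a \<Rightarrow> 'a) \<Rightarrow> 'a \<Rightarrow> 'a" where
  "curv_field M X Y Z p =
     conn M X (conn M Y Z) p - conn M Y (conn M X Z) p - conn M (lie_bracket M X Y) Z p"

text \<open>Rm_p(X,Y,Z,W) = < nabla_X nabla_Y Z - nabla_Y nabla_X Z - nabla_[X,Y] Z, W >,
  evaluated via smooth tangent fields extending the given tangent vectors (tensorial).\<close>
definition Rm :: "'a::euclidean_space set \<Rightarrow> 'a \<Rightarrow> 'a \<Rightarrow> 'a \<Rightarrow> 'a \<Rightarrow> 'a \<Rightarrow> real" where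
  "Rm M p x y z w = (SOME c. \<exists>X Y Z. tangent_field M X \<and> tangent_field M Y \<and> tangent_field M Z \<and>
        X p = x \<and> Y p = y \<and> Z p = z \<and> c = inner (curv_field M X Y Z p) w)"

definition onb :: "'a::euclidean_space set \<Rightarrow> 'a set \<Rightarrow> bool" where
  "onb V B \<longleftrightarrow> B \<subseteq> V \<and> pairwise orthogonal B \<and> (\<forall>x\<in>B. norm x = 1) \<and> span B = V"

definition sec_curv :: "'a::euclidean_space set \<Rightarrow> 'a \<Rightarrow> 'a set \<Rightarrow> real" where
  "sec_curv M p V = (SOME c. \<exists>x y. x \<in> V \<and> y \<in> V \<and> norm x = 1 \<and> norm y = 1 \<and>
        inner x y = 0 \<and> span {x, y} = V \<and> c = Rm M p x y y x)"

definition Ric :: "'a::euclidean_space set \<Rightarrow> 'a \<Rightarrow> 'a \<Rightarrow> 'a \<Rightarrow> real" where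
  "Ric M p x y = (SOME c. \<exists>B. onb (tangent_space M p) B \<and> c = (\<Sum>e\<in>B. Rm M p x e e y))"

definition Scal :: "'a::euclidean_space set \<Rightarrow> 'a \<Rightarrow> real" where
  "Scal M p = (SOME c. \<exists>B. onb (tangent_space M p) B \<and> c = (\<Sum>e\<in>B. Ric M p e e))"

definition orth_planes :: "'a::euclidean_space set \<Rightarrow> 'a \<Rightarrow> nat \<Rightarrow> (nat \<Rightarrow> 'a set) \<Rightarrow> bool" where
  "orth_planes M p r V \<longleftrightarrow>
     (\<forall>j<r. subspace (V j) \<and> V j \<subseteq> tangent_space M p \<and> dim (V j) = 2) \<and>
     (\<forall>i<r. \<forall>j<r. i \<noteq> j \<longrightarrow> (\<forall>x\<in>V i. \<forall>y\<in>V j. orthogonal x y))"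

definition delta_upper :: "'a::euclidean_space set \<Rightarrow> 'a \<Rightarrow> nat \<Rightarrow> real" where
  "delta_upper M p r = Scal M p - Inf {(\<Sum>j<r. sec_curv M p (V j)) | V. orth_planes M p r V}"

definition delta_lower :: "'a::euclidean_space set \<Rightarrow> 'a \<Rightarrow> nat \<Rightarrow> real" where
  "delta_lower M p r = Scal M p - Sup {(\<Sum>j<r. sec_curv M p (V j)) | V. orth_planes M p r V}"

end

theory Submission
  imports Defs
begin

text \<open>
  At \<open>Q\<close> the tangent space consists of the symmetric matrices anticommuting with \<open>Q\<close>: such an \<open>X\<close> is
  the velocity at \<open>0\<close> of \<open>S(t) Q S(t)\<^sup>-\<^sup>1\<close> with \<open>S(t) = 1 + (t/2) X Q\<close>. Differentiating the tangency
  relation \<open>Z(q) q + q Z(q) = 0\<close> along \<open>Y\<close> determines the normal part of \<open>D\<^sub>Y Z\<close>, and since second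
  derivatives commute this gives \<open>Rm(x,y,z,w) = 1/4 \<langle>[[x,y],z],w\<rangle>\<close>; the sectional curvature of an
  orthonormal pair is \<open>1/4 |[x,y]|\<^sup>2\<close>.

  The entrywise sums of \<open>e\<^sub>i\<^sub>j e\<^sub>k\<^sub>l\<close> over an orthonormal basis of the tangent space are the entries of the
  orthogonal projection, which yields the dimension \<open>k (n - k)\<close> and the Einstein constant \<open>(n - 2)/8\<close>
  without diagonalising \<open>Q\<close>.

  For the bound \<open>|[x,y]| \<le> |x| |y|\<close> take an eigenbasis of \<open>x\<close>. As \<open>Q\<close> maps the \<open>l\<close>-eigenspace to the
  \<open>-l\<close>-eigenspace, eigenvalues \<open>l\<close>, \<open>m\<close> coupled by a nonzero entry of \<open>y\<close> satisfy
  \<open>(l - m)\<^sup>2 \<le> 2 l\<^sup>2 + 2 m\<^sup>2 \<le> |x|\<^sup>2\<close>, because \<open>l, -l, m, -m\<close> occur in the spectrum of \<open>x\<close> with enough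
  multiplicity. Each \<open>2 \<times> 2\<close> block of the off-diagonal part contains two orthogonal planes of
  curvature \<open>1/4\<close>, spanned by \<open>E\<^sub>1\<^sub>1 \<plusminus> E\<^sub>2\<^sub>2\<close> and \<open>E\<^sub>1\<^sub>2 \<mp> E\<^sub>2\<^sub>1\<close>, and two flat ones, spanned by
  \<open>E\<^sub>1\<^sub>1, E\<^sub>2\<^sub>2\<close> and by \<open>E\<^sub>1\<^sub>2, E\<^sub>2\<^sub>1\<close>.
\<close>

section \<open>Tangent spaces of the Grassmannian\<close>

text \<open>Registering the matrix product as bounded bilinear supplies distributivity, the product
  rule \<open>mm.FDERIV\<close> and a norm bound, all used below.\<close>

lemma bounded_bilinear_matrix_mult:
  "bounded_bilinear ((**) :: real^'n^'n \<Rightarrow> real^'n^'n \<Rightarrow> real^'n^'n)"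
proof -
  have "bilinear ((**) :: real^'n^'n \<Rightarrow> real^'n^'n \<Rightarrow> real^'n^'n)"
    unfolding bilinear_def
    by (auto intro!: linearI simp: matrix_matrix_mult_def vec_eq_iff sum.distrib
        algebra_simps sum_distrib_left)
  then show ?thesis
    by (simp add: bilinear_conv_bounded_bilinear)
qed

interpretation mm: bounded_bilinear "(**) :: real^'n^'n \<Rightarrow> real^'n^'n \<Rightarrow> real^'n^'n"
  by (rule bounded_bilinear_matrix_mult)

lemmas mm_distribs = mm.add_left mm.add_right mm.diff_left mm.diff_right
  mm.minus_left mm.minus_right mm.scaleR_left mm.scaleR_right

lemma transpose_add: "transpose (A + B) = transpose A + transpose (B :: real^'n^'m)"
  and transpose_diff: "transpose (A - B) = transpose A - transpose B"
  and transpose_uminus: "transpose (- A) = - transpose A"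
  and transpose_scaleR: "transpose (c *\<^sub>R A) = c *\<^sub>R transpose A"
  and transpose_zero: "transpose (0 :: real^'n^'m) = 0"
  by (simp_all add: transpose_def vec_eq_iff)

lemmas transpose_linear = transpose_add transpose_diff transpose_uminus transpose_scaleR transpose_zero

lemma bounded_linear_transpose: "bounded_linear (transpose :: real^'n^'m \<Rightarrow> real^'m^'n)"
  by (intro linear_conv_bounded_linear[THEN iffD1] linearI) (simp_all add: transpose_linear)

lemma inner_matrix_eq_sum: "inner A B = (\<Sum>i\<in>UNIV. \<Sum>j\<in>UNIV. A $ i $ j * B $ i $ (j::'n))"
  for A B :: "real^'n^'m"
  by (simp add: inner_vec_def)

lemma inner_transpose: "inner (transpose A) (transpose B) = inner A (B :: real^'n^'m)"
  unfolding inner_matrix_eq_sum transpose_def by (simp, rule sum.swap)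

lemma inner_matrix_eq_trace: "inner A B = trace (transpose A ** B)" for A B :: "real^'n^'n"
  unfolding inner_matrix_eq_sum trace_def matrix_matrix_mult_def transpose_def
  by (simp, rule sum.swap)

lemma inner_matrix_mult_left: "inner (A ** M) N = inner M (transpose A ** N)"
  for A M N :: "real^'n^'n"
  by (simp add: inner_matrix_eq_trace matrix_transpose_mul matrix_mul_assoc)

lemma inner_matrix_mult_right: "inner (M ** A) N = inner M (N ** transpose A)"
  for A M N :: "real^'n^'n"
proof -
  have "inner (M ** A) N = inner (transpose A ** transpose M) (transpose N)"
    by (metis inner_transpose matrix_transpose_mul)
  also have "\<dots> = inner (transpose M) (A ** transpose N)"
    by (simp add: inner_matrix_mult_left)
  also have "\<dots> = inner M (N ** transpose A)"
    by (metis inner_transpose matrix_transpose_mul transpose_transpose)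
  finally show ?thesis .
qed

text \<open>The candidate tangent space. In an eigenbasis of the involution \<open>Q\<close> these
  are the symmetric matrices whose two diagonal blocks vanish.\<close>

definition odd_sym :: "real^'n^'n \<Rightarrow> (real^'n^'n) set" where
  "odd_sym Q = {X. transpose X = X \<and> X ** Q + Q ** X = 0}"

lemma GrassD:
  fixes Q :: "real^'n^'n"
  assumes "Q \<in> Grass k"
  shows "transpose Q = Q" "Q ** Q = mat 1" "trace Q = 2 * real k - real CARD('n)"
  using assms by (auto simp: Grass_def)

lemma odd_symD:
  assumes "X \<in> odd_sym Q"
  shows "transpose X = X" "X ** Q = - (Q ** X)" "Q ** X = - (X ** Q)"
proof -
  have *: "transpose X = X" "X ** Q + Q ** X = 0"
    using assms by (auto simp: odd_sym_def)
  show "transpose X = X" by (rule *)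
  show "X ** Q = - (Q ** X)" using *(2) by (simp only: eq_neg_iff_add_eq_0)
  then show "Q ** X = - (X ** Q)" by simp
qed

lemma subspace_odd_sym: "subspace (odd_sym Q)" for Q :: "real^'n^'n"
proof -
  have "linear (\<lambda>X :: real^'n^'n. transpose X - X)" "linear (\<lambda>X. X ** Q + Q ** X)"
    by (auto intro!: linearI simp: transpose_linear mm_distribs algebra_simps)
  moreover have "odd_sym Q = {X. transpose X - X = 0} \<inter> {X. X ** Q + Q ** X = 0}"
    by (auto simp: odd_sym_def)
  ultimately show ?thesis
    by (simp only: subspace_inter linear_subspace_kernel)
qed

text \<open>For skew \<open>A\<close> the matrices \<open>M\<close> and \<open>A ** M\<close> are
  orthogonal, so |SM|^2 = |M|^2 + |AM|^2. Hence \<open>S\<close> is injective, and taking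
  \<open>M\<close> to be the inverse gives a norm bound that does not depend on
  \<open>A\<close>.\<close>

lemma matrix_inv_one_plus_skew:
  fixes A :: "real^'n^'n"
  assumes skew: "transpose A = - A"
  defines "S \<equiv> mat 1 + A"
  shows "S ** matrix_inv S = mat 1" "matrix_inv S ** S = mat 1"
    "norm (matrix_inv S) \<le> norm (mat 1 :: real^'n^'n)"
proof -
  have expand: "norm M \<le> norm (S ** M)" for M :: "real^'n^'n"
  proof -
    have "inner (A ** M) M = - inner M (A ** M)"
      unfolding inner_matrix_mult_left skew mm.minus_left by simp
    then have "inner (A ** M) M = 0" "inner M (A ** M) = 0" by (simp_all add: inner_commute)
    then have "inner (S ** M) (S ** M) = inner M M + inner (A ** M) (A ** M)"
      by (simp add: S_def mm_distribs inner_add)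
    then show ?thesis by (simp add: norm_le)
  qed
  have "\<exists>B. B ** S = mat 1"
    unfolding matrix_left_invertible_ker
  proof (intro allI impI)
    fix v assume v: "S *v v = 0"
    \<comment> \<open>All columns of \<open>M\<close> equal the kernel vector \<open>v\<close>, so
      the matrix estimate \<open>expand\<close> applies to it.\<close>
    define M :: "real^'n^'n" where "M = (\<chi> i j. v $ i)"
    have "S ** M = 0"
      using v by (simp add: M_def matrix_matrix_mult_def matrix_vector_mult_def vec_eq_iff)
    with expand[of M] have "M = 0" by simp
    then show "v = 0" by (simp add: M_def vec_eq_iff)
  qed
  then have "invertible S" by (simp add: invertible_left_inverse)
  then show *: "S ** matrix_inv S = mat 1" "matrix_inv S ** S = mat 1"
    unfolding invertible_def matrix_inv_def by (metis (mono_tags, lifting) someI_ex)+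
  show "norm (matrix_inv S) \<le> norm (mat 1 :: real^'n^'n)"
    using expand[of "matrix_inv S"] * by simp
qed

text \<open>The definition of \<open>tangent_space\<close> asks for a curve that stays in the
  manifold for every real time. \<open>A\<close> is skew, so \<open>S t\<close> is invertible for
  all \<open>t\<close> and the conjugated curve \<open>g\<close> is globally defined.\<close>

lemma odd_sym_subset_tangent_space:
  fixes Q :: "real^'n^'n"
  assumes Q: "Q \<in> Grass k" and X: "X \<in> odd_sym Q"
  shows "X \<in> tangent_space (Grass k) Q"
proof -
  note Qs = GrassD[OF Q] and Xs = odd_symD[OF X]
  define A where "A = (1/2) *\<^sub>R (X ** Q)"
  have Ask: "transpose A = - A"
    using Qs Xs by (simp add: A_def transpose_linear matrix_transpose_mul)
  have AQ: "A ** Q = (1/2) *\<^sub>R X"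
    using Qs by (simp add: A_def mm_distribs flip: matrix_mul_assoc)
  have QA: "Q ** A = - (1/2) *\<^sub>R X"
    using Qs by (simp add: A_def mm_distribs matrix_mul_assoc Xs(3)) (simp flip: matrix_mul_assoc)
  define S where "S t = mat 1 + t *\<^sub>R A" for t
  define R where "R t = matrix_inv (S t)" for t
  have SR: "S t ** R t = mat 1" "R t ** S t = mat 1" "norm (R t) \<le> norm (mat 1 :: real^'n^'n)" for t
    using matrix_inv_one_plus_skew[of "t *\<^sub>R A"] Ask by (simp_all add: S_def R_def transpose_linear)
  define g where "g t = S t ** Q ** R t" for t
  \<comment> \<open>\<open>Q\<close> anticommutes with \<open>A\<close>, so it intertwines
    \<open>S t\<close> with its transpose. Together with the normality of \<open>S t\<close>
    (\<open>com\<close>) this makes the conjugate \<open>g t\<close> symmetric.\<close>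
  have QS: "Q ** S t = transpose (S t) ** Q" for t
    by (simp add: S_def transpose_linear mm_distribs AQ QA Ask transpose_mat)
  have SQ: "Q ** transpose (S t) = S t ** Q" for t
    by (simp add: S_def transpose_linear mm_distribs AQ QA Ask transpose_mat)
  have com: "S t ** transpose (S t) = transpose (S t) ** S t" for t
    unfolding S_def by (simp add: transpose_linear mm_distribs Ask transpose_mat algebra_simps scaleR_2)
  have g_mem: "g t \<in> Grass k" for t
  proof -
    have "transpose (g t) = transpose (R t) ** Q ** transpose (S t)"
      by (simp add: g_def matrix_transpose_mul Qs matrix_mul_assoc)
    also have "\<dots> = transpose (R t) ** S t ** Q ** (S t ** R t)"
      by (simp add: SR SQ flip: matrix_mul_assoc)
    also have "\<dots> = transpose (R t) ** S t ** (Q ** S t) ** R t"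
      by (simp only: matrix_mul_assoc)
    also have "\<dots> = transpose (R t) ** (S t ** transpose (S t)) ** Q ** R t"
      by (simp only: QS matrix_mul_assoc)
    also have "\<dots> = transpose (R t) ** transpose (S t) ** S t ** Q ** R t"
      by (simp only: com matrix_mul_assoc)
    also have "\<dots> = g t"
      by (simp add: SR g_def transpose_mat flip: matrix_transpose_mul)
    finally have 1: "transpose (g t) = g t" .
    have "g t ** g t = S t ** Q ** (R t ** S t) ** Q ** R t"
      by (simp add: g_def matrix_mul_assoc)
    also have "\<dots> = mat 1" by (simp add: SR) (simp add: Qs SR flip: matrix_mul_assoc)
    finally have 2: "g t ** g t = mat 1" .
    have "trace (g t) = trace (R t ** (S t ** Q))"
      unfolding g_def by (rule trace_mul_sym)
    then have "trace (g t) = trace Q" by (simp add: matrix_mul_assoc SR)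
    with 1 2 Qs show ?thesis by (simp add: Grass_def)
  qed
  \<comment> \<open>An exact Taylor remainder: \<open>g t - Q\<close> equals t X R(t), and R(t) - 1
    equals -t A R(t). The uniform bound on \<open>R t\<close> then makes the remainder
    O(t^2).\<close>
  have g_diff: "g t - Q - t *\<^sub>R X = - (t\<^sup>2) *\<^sub>R (X ** A ** R t)" for t
  proof -
    have "g t - Q = (S t ** Q - Q ** S t) ** R t"
      by (simp add: g_def mm_distribs) (simp add: SR flip: matrix_mul_assoc)
    also have "S t ** Q - Q ** S t = t *\<^sub>R X"
      by (simp add: S_def mm_distribs AQ QA flip: scaleR_add_left)
    finally have "g t - Q - t *\<^sub>R X = t *\<^sub>R (X ** (R t - mat 1))"
      by (simp add: mm_distribs algebra_simps)
    also have "R t - mat 1 = - t *\<^sub>R (A ** R t)"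
      using SR(1)[of t] by (simp add: S_def mm_distribs algebra_simps)
    finally show ?thesis
      by (simp add: mm_distribs matrix_mul_assoc power2_eq_square)
  qed
  obtain K where K: "\<And>(M :: real^'n^'n) (N :: real^'n^'n). norm (M ** N) \<le> norm M * norm N * K"
    using bounded_bilinear.bounded[OF bounded_bilinear_matrix_mult[where 'n='n]] by metis
  define C where "C = norm (X ** A) * norm (mat 1 :: real^'n^'n) * \<bar>K\<bar>"
  have bound: "norm (g t - Q - t *\<^sub>R X) \<le> t\<^sup>2 * C" for t
  proof -
    have "norm (X ** A ** R t) \<le> norm (X ** A) * norm (R t) * \<bar>K\<bar>"
      by (rule order.trans[OF K]) (auto intro: mult_left_mono)
    also have "\<dots> \<le> C" unfolding C_def
      by (intro mult_right_mono mult_left_mono SR) auto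
    finally show ?thesis unfolding g_diff by (simp add: mult_left_mono)
  qed
  have g0: "g 0 = Q" using g_diff[of 0] by simp
  have "(g has_vector_derivative X) (at 0)"
    unfolding has_vector_derivative_def
  proof (rule has_derivativeI_sandwich[of 1 _ _ _ _ "\<lambda>t. \<bar>t\<bar> * C"])
    show "bounded_linear (\<lambda>x. x *\<^sub>R X)" by (rule bounded_linear_scaleR_left)
    show "norm (g t - g 0 - (t - 0) *\<^sub>R X) / norm (t - 0) \<le> \<bar>t\<bar> * C"
      if "t \<noteq> 0" for t
      using bound[of t] that g0 by (simp add: divide_le_eq power2_eq_square mult_ac)
    show "((\<lambda>t. \<bar>t\<bar> * C) \<longlongrightarrow> 0) (at 0)"
      by (auto intro!: tendsto_eq_intros)
  qed auto
  with g0 g_mem show ?thesis unfolding tangent_space_def by blast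
qed

text \<open>The remaining inclusion follows by differentiating symmetry and Q^2 = 1 along a curve in
  the manifold.\<close>

lemma tangent_space_Grass:
  fixes Q :: "real^'n^'n"
  assumes Q: "Q \<in> Grass k"
  shows "tangent_space (Grass k) Q = odd_sym Q"
proof
  show "odd_sym Q \<subseteq> tangent_space (Grass k) Q"
    using odd_sym_subset_tangent_space[OF Q] by blast
  show "tangent_space (Grass k) Q \<subseteq> odd_sym Q"
  proof
    fix X assume "X \<in> tangent_space (Grass k) Q"
    then obtain g where g: "g 0 = Q" "\<And>t. g t \<in> Grass k" "(g has_vector_derivative X) (at 0)"
      unfolding tangent_space_def by blast
    note gd = g(3)[unfolded has_vector_derivative_def]
    have "((\<lambda>t. transpose (g t)) has_derivative (\<lambda>t. transpose (t *\<^sub>R X))) (at 0)"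
      by (rule bounded_linear.has_derivative[OF bounded_linear_transpose gd])
    moreover have "(\<lambda>t. transpose (g t)) = g" using GrassD(1)[OF g(2)] by auto
    ultimately have "(\<lambda>t. transpose (t *\<^sub>R X)) = (\<lambda>t. t *\<^sub>R X)"
      using has_derivative_unique gd by metis
    from fun_cong[OF this, of 1] have 1: "transpose X = X" by simp
    have "((\<lambda>t. g t ** g t) has_derivative (\<lambda>t. g 0 ** (t *\<^sub>R X) + (t *\<^sub>R X) ** g 0)) (at 0)"
      by (rule mm.FDERIV[OF gd gd])
    moreover have "(\<lambda>t. g t ** g t) = (\<lambda>t. mat 1)" using GrassD(2)[OF g(2)] by auto
    ultimately have "((\<lambda>t. mat 1) has_derivative (\<lambda>t. g 0 ** (t *\<^sub>R X) + (t *\<^sub>R X) ** g 0)) (at 0)"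
      by simp
    from has_derivative_unique[OF this has_derivative_const]
    have "(\<lambda>t. g 0 ** (t *\<^sub>R X) + (t *\<^sub>R X) ** g 0) = (\<lambda>t. 0)" .
    from fun_cong[OF this, of 1] have 2: "X ** Q + Q ** X = 0"
      by (simp add: g add.commute)
    show "X \<in> odd_sym Q" using 1 2 by (simp add: odd_sym_def)
  qed
qed

section \<open>Orthogonal projection onto the tangent space\<close>

lemma closest_point_subspace:
  fixes S :: "'a::euclidean_space set"
  assumes "subspace S" "x \<in> S" "\<And>y. y \<in> S \<Longrightarrow> inner (a - x) y = 0"
  shows "closest_point S a = x"
proof (rule closest_point_unique[symmetric])
  show "convex S" "closed S" "x \<in> S"
    using assms by (auto intro: subspace_imp_convex closed_subspace)
  show "\<forall>z\<in>S. dist a x \<le> dist a z"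
  proof
    fix z assume "z \<in> S"
    then have "inner (a - x) (x - z) = 0" using assms subspace_diff by blast
    then have "(norm (a - z))\<^sup>2 = (norm (a - x))\<^sup>2 + (norm (x - z))\<^sup>2"
      using norm_add_Pythagorean[of "a - x" "x - z"] by (simp add: orthogonal_def)
    then have "(norm (a - x))\<^sup>2 \<le> (norm (a - z))\<^sup>2" by simp
    then show "dist a x \<le> dist a z"
      unfolding dist_norm by (rule power2_le_imp_le) simp
  qed
qed

text \<open>A composite of two commuting orthogonal projections, symmetrisation and W -> (W -
  QWQ)/2, each contributing a factor 1/2.\<close>

definition odd_proj :: "real^'n^'n \<Rightarrow> real^'n^'n \<Rightarrow> real^'n^'n" where
  "odd_proj Q V = (1/4) *\<^sub>R (V + transpose V - Q ** (V + transpose V) ** Q)"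

lemma odd_proj_in:
  assumes "Q \<in> Grass k" shows "odd_proj Q V \<in> odd_sym Q"
proof -
  note Qs = GrassD[OF assms]
  define W where "W = V + transpose V"
  have W: "transpose W = W" by (simp add: W_def transpose_linear add.commute)
  have *: "Q ** (Q ** W) = W" "Q ** (Q ** (W ** Q)) = W ** Q"
    by (simp_all add: matrix_mul_assoc Qs)
  show ?thesis
    unfolding odd_proj_def odd_sym_def W_def[symmetric]
    by (simp add: transpose_linear matrix_transpose_mul mm_distribs W Qs * flip: matrix_mul_assoc scaleR_add_right)
qed

lemma inner_odd_proj:
  assumes Q: "Q \<in> Grass k" and Y: "Y \<in> odd_sym Q"
  shows "inner (odd_proj Q V) Y = inner V Y"
proof -
  have t: "inner (transpose V) Y = inner V Y"
    using inner_transpose[of V Y] odd_symD(1)[OF Y] by simp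
  have *: "Q ** Y ** Q = - Y"
    by (simp add: odd_symD(3)[OF Y] mm_distribs GrassD[OF Q] flip: matrix_mul_assoc)
  have "inner (Q ** (V + transpose V) ** Q) Y = - inner (V + transpose V) Y"
    by (simp only: inner_matrix_mult_right[of "Q ** _"] inner_matrix_mult_left[of Q]
        matrix_mul_assoc GrassD[OF Q] * inner_minus_right)
  then show ?thesis by (simp add: odd_proj_def inner_add inner_diff t)
qed

lemma tproj_Grass:
  assumes Q: "Q \<in> Grass k"
  shows "tproj (Grass k) Q V = odd_proj Q V"
  unfolding tproj_def tangent_space_Grass[OF Q]
  by (rule closest_point_subspace)
     (auto simp: inner_diff_left intro: subspace_odd_sym odd_proj_in[OF Q] inner_odd_proj[OF Q, symmetric])

section \<open>Derivatives along a subset and symmetry of second derivatives\<close>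

text \<open>A derivative within a thin set need not be unique, but composing with a curve in
  \<open>M\<close> fixes its values on tangent vectors. This makes the choice in
  \<open>dir_deriv\<close> determinate there.\<close>

lemma has_derivative_within_tangent_unique:
  assumes f1: "(f has_derivative f1) (at p within M)" and f2: "(f has_derivative f2) (at p within M)"
    and v: "v \<in> tangent_space M p"
  shows "f1 v = f2 v"
proof -
  obtain g where g: "g 0 = p" "\<And>t. g t \<in> M" "(g has_vector_derivative v) (at (0::real))"
    using v unfolding tangent_space_def by blast
  note gd = g(3)[unfolded has_vector_derivative_def]
  have M: "range g \<subseteq> M" using g(2) by auto
  have *: "((\<lambda>t. f (g t)) has_derivative (\<lambda>t. f' (t *\<^sub>R v))) (at 0)"
    if "(f has_derivative f') (at p within M)" for f'
    using has_derivative_in_compose[OF gd has_derivative_subset[OF that[folded g(1)] M]] .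
  from fun_cong[OF has_derivative_unique[OF *[OF f1] *[OF f2]], of 1] show ?thesis by simp
qed

lemma dir_deriv_eq:
  assumes f: "(f has_derivative f') (at p within M)" and v: "v \<in> tangent_space M p"
  shows "dir_deriv M f p v = f' v"
  unfolding dir_deriv_def
proof (rule someI2)
  show "\<exists>g. (f has_derivative g) (at p within M) \<and> g v = f' v"
    using f by blast
next
  fix w assume "\<exists>g. (f has_derivative g) (at p within M) \<and> g v = w"
  then show "w = f' v"
    using has_derivative_within_tangent_unique[OF f _ v] by auto
qed

section \<open>Smooth maps and their iterated directional derivatives\<close>

lemma iter_dderiv_append: "iter_dderiv (vs @ ws) f = iter_dderiv vs (iter_dderiv ws f)"
  by (induction vs) auto

lemma smooth_mapI:
  assumes "\<And>x. f differentiable (at x)" "\<And>v. smooth_map (\<lambda>x. frechet_derivative f (at x) v)"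
  shows "smooth_map f"
  unfolding smooth_map_def
proof (intro allI)
  fix vs x
  show "iter_dderiv vs f differentiable (at x)"
  \<comment> \<open>The last list entry is the direction differentiated first, so the list is split
    at its end.\<close>
  proof (cases vs rule: rev_cases)
    case Nil
    then show ?thesis using assms(1) by simp
  next
    case (snoc us v)
    then show ?thesis using assms(2)[of v] by (simp add: iter_dderiv_append smooth_map_def)
  qed
qed

lemma smooth_map_const: "smooth_map (\<lambda>_. c)"
proof -
  have "iter_dderiv vs (\<lambda>_::'a. c::'b) = (\<lambda>_. if vs = [] then c else 0)" for vs
    by (induction vs) (auto simp: frechet_derivative_const)
  then show ?thesis unfolding smooth_map_def by simp
qed

lemma smooth_map_bounded_linear:
  assumes "bounded_linear f"
  shows "smooth_map f"
proof (rule smooth_mapI)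
  have d: "(f has_derivative f) (at x)" for x
    by (rule bounded_linear_imp_has_derivative[OF assms])
  show "f differentiable (at x)" for x using d by (auto simp: differentiable_def)
  have "frechet_derivative f (at x) = f" for x using frechet_derivative_at[OF d] by simp
  then show "smooth_map (\<lambda>x. frechet_derivative f (at x) v)" for v
    by (simp add: smooth_map_const)
qed

lemma smooth_map_has_derivative:
  assumes "smooth_map f"
  shows "(iter_dderiv vs f has_derivative (\<lambda>v. iter_dderiv (v # vs) f x)) (at x)"
  using assms unfolding smooth_map_def
  by (simp add: frechet_derivative_works[symmetric])

lemma smooth_map_frechet_derivative:
  "smooth_map f \<Longrightarrow> (f has_derivative frechet_derivative f (at x)) (at x)"
  using smooth_map_has_derivative[of f "[]" x] by simp

declare iter_dderiv.simps(2) [simp del]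

text \<open>The mean value theorem is applied twice, first in direction \<open>u\<close> and then in
  direction \<open>v\<close>. Pairing with \<open>b\<close> makes the functions real-valued, as that
  theorem requires.\<close>

lemma mixed_difference_eq_mixed_derivative:
  fixes f :: "'a::real_normed_vector \<Rightarrow> 'b::real_inner"
  assumes f: "smooth_map f" and t: "t > 0"
  shows "\<exists>s s'. 0 < s \<and> s < t \<and> 0 < s' \<and> s' < t \<and>
    inner (f (x + t *\<^sub>R u + t *\<^sub>R v) - f (x + t *\<^sub>R u) - f (x + t *\<^sub>R v) + f x) b
      = t\<^sup>2 * inner (iter_dderiv [v, u] f (x + s *\<^sub>R u + s' *\<^sub>R v)) b"
proof -
  have deriv: "((\<lambda>s. inner (iter_dderiv vs f (p + s *\<^sub>R w)) b) has_real_derivative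
      inner (iter_dderiv (w # vs) f (p + s *\<^sub>R w)) b) (at s)" for vs p w s
  proof -
    have "((\<lambda>s. p + s *\<^sub>R w) has_vector_derivative w) (at s)"
      by (auto intro!: derivative_eq_intros)
    from vector_derivative_diff_chain_within[OF this has_derivative_at_withinI[OF smooth_map_has_derivative[OF f]]]
    have "((\<lambda>s. iter_dderiv vs f (p + s *\<^sub>R w)) has_vector_derivative
        iter_dderiv (w # vs) f (p + s *\<^sub>R w)) (at s)" by (simp add: o_def)
    from bounded_linear.has_vector_derivative[OF bounded_linear_inner_left this, of b]
    show ?thesis by (simp add: has_real_derivative_iff_has_vector_derivative)
  qed
  define \<phi> where "\<phi> s = inner (f (x + t *\<^sub>R v + s *\<^sub>R u)) b - inner (f (x + s *\<^sub>R u)) b" for s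
  have "(\<phi> has_real_derivative inner (iter_dderiv [u] f (x + t *\<^sub>R v + s *\<^sub>R u)) b
      - inner (iter_dderiv [u] f (x + s *\<^sub>R u)) b) (at s)" for s
    unfolding \<phi>_def using DERIV_diff[OF deriv[of "[]" _ u s] deriv[of "[]" _ u s]] by simp
  then obtain s where s: "0 < s" "s < t" "\<phi> t - \<phi> 0 = t * (inner (iter_dderiv [u] f (x + t *\<^sub>R v + s *\<^sub>R u)) b
      - inner (iter_dderiv [u] f (x + s *\<^sub>R u)) b)"
    using MVT2[OF t, of \<phi>] by force
  obtain s' where s': "0 < s'" "s' < t"
    "inner (iter_dderiv [u] f (x + s *\<^sub>R u + t *\<^sub>R v)) b - inner (iter_dderiv [u] f (x + s *\<^sub>R u + 0 *\<^sub>R v)) b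
      = t * inner (iter_dderiv [v, u] f (x + s *\<^sub>R u + s' *\<^sub>R v)) b"
    using MVT2[OF t, of _ "\<lambda>s'. inner (iter_dderiv [v, u] f (x + s *\<^sub>R u + s' *\<^sub>R v)) b",
        OF deriv[of "[u]" "x + s *\<^sub>R u" v]] by force
  have "inner (f (x + t *\<^sub>R u + t *\<^sub>R v) - f (x + t *\<^sub>R u) - f (x + t *\<^sub>R v) + f x) b = \<phi> t - \<phi> 0"
    by (simp add: \<phi>_def inner_diff_left inner_add_left ac_simps)
  also have "\<dots> = t\<^sup>2 * inner (iter_dderiv [v, u] f (x + s *\<^sub>R u + s' *\<^sub>R v)) b"
    using s(3) s'(3) by (simp add: power2_eq_square ac_simps)
  finally show ?thesis using s s' by blast
qed

text \<open>The second difference is symmetric in \<open>u\<close> and \<open>v\<close>. Evaluating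
  it in both orders and shrinking the step sends both intermediate points to \<open>x\<close>, where
  the second derivatives are continuous.\<close>

lemma iter_dderiv_commute:
  fixes f :: "'a::real_normed_vector \<Rightarrow> 'b::real_inner"
  assumes f: "smooth_map f"
  shows "iter_dderiv [u, v] f x = iter_dderiv [v, u] f x"
proof -
  have lim: "\<exists>\<xi>. \<xi> \<longlonglongrightarrow> x \<and> (\<forall>n. inner (f (x + T n *\<^sub>R u + T n *\<^sub>R v) - f (x + T n *\<^sub>R u) - f (x + T n *\<^sub>R v) + f x) b
      = (T n)\<^sup>2 * inner (iter_dderiv [v, u] f (\<xi> n)) b)"
    if T: "T \<longlonglongrightarrow> 0" "\<And>n. T n > 0" for u v b and T :: "nat \<Rightarrow> real"
  proof -
    have "\<forall>n. \<exists>p. 0 < fst p \<and> fst p < T n \<and> 0 < snd p \<and> snd p < T n \<and>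
      inner (f (x + T n *\<^sub>R u + T n *\<^sub>R v) - f (x + T n *\<^sub>R u) - f (x + T n *\<^sub>R v) + f x) b
      = (T n)\<^sup>2 * inner (iter_dderiv [v, u] f (x + fst p *\<^sub>R u + snd p *\<^sub>R v)) b"
      using mixed_difference_eq_mixed_derivative[OF f T(2), where x = x and u = u and v = v and b = b]
      by simp
    from choice[OF this] obtain p where p: "\<And>n. 0 < fst (p n)" "\<And>n. fst (p n) < T n"
      "\<And>n. 0 < snd (p n)" "\<And>n. snd (p n) < T n"
      "\<And>n. inner (f (x + T n *\<^sub>R u + T n *\<^sub>R v) - f (x + T n *\<^sub>R u) - f (x + T n *\<^sub>R v) + f x) b
      = (T n)\<^sup>2 * inner (iter_dderiv [v, u] f (x + fst (p n) *\<^sub>R u + snd (p n) *\<^sub>R v)) b"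
      by auto
    have "(\<lambda>n. fst (p n)) \<longlonglongrightarrow> 0"
      by (rule tendsto_sandwich[OF _ _ tendsto_const T(1)])
         (intro always_eventually allI less_imp_le p(1,2))+
    moreover have "(\<lambda>n. snd (p n)) \<longlonglongrightarrow> 0"
      by (rule tendsto_sandwich[OF _ _ tendsto_const T(1)])
         (intro always_eventually allI less_imp_le p(3,4))+
    ultimately have "(\<lambda>n. x + fst (p n) *\<^sub>R u + snd (p n) *\<^sub>R v) \<longlonglongrightarrow> x + 0 *\<^sub>R u + 0 *\<^sub>R v"
      by (intro tendsto_intros)
    with p(5) show ?thesis by auto
  qed
  have "inner (iter_dderiv [u, v] f x) b = inner (iter_dderiv [v, u] f x) b" for b
  proof -
    define T where "T n = inverse (real (Suc n))" for n
    have T: "T \<longlonglongrightarrow> 0" "\<And>n. T n > 0"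
      unfolding T_def by (rule LIMSEQ_inverse_real_of_nat) simp
    obtain \<xi> where \<xi>: "\<xi> \<longlonglongrightarrow> x" "\<And>n. inner (f (x + T n *\<^sub>R u + T n *\<^sub>R v) - f (x + T n *\<^sub>R u) - f (x + T n *\<^sub>R v) + f x) b
      = (T n)\<^sup>2 * inner (iter_dderiv [v, u] f (\<xi> n)) b" using lim[OF T] by metis
    obtain \<eta> where \<eta>: "\<eta> \<longlonglongrightarrow> x" "\<And>n. inner (f (x + T n *\<^sub>R v + T n *\<^sub>R u) - f (x + T n *\<^sub>R v) - f (x + T n *\<^sub>R u) + f x) b
      = (T n)\<^sup>2 * inner (iter_dderiv [u, v] f (\<eta> n)) b" using lim[OF T] by metis
    have eq: "inner (iter_dderiv [v, u] f (\<xi> n)) b = inner (iter_dderiv [u, v] f (\<eta> n)) b" for n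
    proof -
      have "(T n)\<^sup>2 * inner (iter_dderiv [v, u] f (\<xi> n)) b = (T n)\<^sup>2 * inner (iter_dderiv [u, v] f (\<eta> n)) b"
        unfolding \<xi>(2)[symmetric] \<eta>(2)[symmetric] by (simp add: algebra_simps)
      then show ?thesis using T(2)[of n] by simp
    qed
    have cont: "isCont (iter_dderiv vs f) x" for vs
      using smooth_map_has_derivative[OF f] has_derivative_continuous by blast
    have "(\<lambda>n. inner (iter_dderiv [v, u] f (\<xi> n)) b) \<longlonglongrightarrow> inner (iter_dderiv [v, u] f x) b"
      by (intro tendsto_inner tendsto_const isCont_tendsto_compose[OF cont \<xi>(1)])
    moreover have "(\<lambda>n. inner (iter_dderiv [u, v] f (\<eta> n)) b) \<longlonglongrightarrow> inner (iter_dderiv [u, v] f x) b"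
      by (intro tendsto_inner tendsto_const isCont_tendsto_compose[OF cont \<eta>(1)])
    ultimately show ?thesis using eq LIMSEQ_unique by auto
  qed
  then show ?thesis using vector_eq_rdot by blast
qed

text \<open>The base point and the direction both vary with \<open>q\<close>. Expanding the
  direction \<open>Y q\<close> in \<open>Basis\<close> reduces the claim to a product rule with
  finitely many terms.\<close>

lemma has_derivative_directional_derivative:
  fixes Y Z :: "'a::euclidean_space \<Rightarrow> 'a"
  assumes Y: "smooth_map Y" and Z: "smooth_map Z"
  shows "((\<lambda>q. frechet_derivative Z (at q) (Y q)) has_derivative
     (\<lambda>h. iter_dderiv [h, Y p] Z p + frechet_derivative Z (at p) (frechet_derivative Y (at p) h))) (at p)"
proof -
  have dZ: "(Z has_derivative frechet_derivative Z (at q)) (at q)" for q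
    by (rule smooth_map_frechet_derivative[OF Z])
  have dY: "(Y has_derivative frechet_derivative Y (at q)) (at q)" for q
    by (rule smooth_map_frechet_derivative[OF Y])
  have expand: "frechet_derivative Z (at q) y = (\<Sum>b\<in>Basis. inner y b *\<^sub>R iter_dderiv [b] Z q)" for q y
  proof -
    have lin: "linear (frechet_derivative Z (at q))" using dZ by (rule has_derivative_linear)
    show ?thesis
      using linear_sum[OF lin, of "\<lambda>b. inner y b *\<^sub>R b" Basis]
      by (simp add: euclidean_representation linear_scale[OF lin] iter_dderiv.simps)
  qed
  have d1: "(iter_dderiv [b] Z has_derivative (\<lambda>h. iter_dderiv [h, b] Z p)) (at p)" for b
    by (rule smooth_map_has_derivative[OF Z])
  have "((\<lambda>q. \<Sum>b\<in>Basis. inner (Y p) b *\<^sub>R iter_dderiv [b] Z q) has_derivative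
      (\<lambda>h. \<Sum>b\<in>Basis. inner (Y p) b *\<^sub>R iter_dderiv [h, b] Z p)) (at p)"
    by (intro has_derivative_sum has_derivative_scaleR_right d1)
  moreover have "(\<lambda>q. \<Sum>b\<in>Basis. inner (Y p) b *\<^sub>R iter_dderiv [b] Z q) = iter_dderiv [Y p] Z"
    by (rule ext, subst expand[symmetric]) (simp add: iter_dderiv.simps)
  ultimately have "(iter_dderiv [Y p] Z has_derivative
      (\<lambda>h. \<Sum>b\<in>Basis. inner (Y p) b *\<^sub>R iter_dderiv [h, b] Z p)) (at p)"
    by simp
  \<comment> \<open>With the direction frozen at \<open>Y p\<close>, two derivatives of the same map
    are compared; this is linearity of the second derivative in its inner direction.\<close>
  from has_derivative_unique[OF this d1] have e2: "(\<lambda>h. \<Sum>b\<in>Basis. inner (Y p) b *\<^sub>R iter_dderiv [h, b] Z p) = (\<lambda>h. iter_dderiv [h, Y p] Z p)"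
    .
  have "((\<lambda>q. \<Sum>b\<in>Basis. inner (Y q) b *\<^sub>R iter_dderiv [b] Z q) has_derivative
      (\<lambda>h. \<Sum>b\<in>Basis. inner (Y p) b *\<^sub>R iter_dderiv [h, b] Z p + inner (frechet_derivative Y (at p) h) b *\<^sub>R iter_dderiv [b] Z p)) (at p)"
    by (intro has_derivative_sum has_derivative_scaleR has_derivative_inner_left dY d1)
  also have "(\<lambda>h. \<Sum>b\<in>Basis. inner (Y p) b *\<^sub>R iter_dderiv [h, b] Z p + inner (frechet_derivative Y (at p) h) b *\<^sub>R iter_dderiv [b] Z p)
    = (\<lambda>h. iter_dderiv [h, Y p] Z p + frechet_derivative Z (at p) (frechet_derivative Y (at p) h))"
    by (rule ext) (simp only: sum.distrib fun_cong[OF e2] expand[symmetric])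
  finally show ?thesis by (simp only: expand[symmetric])
qed

section \<open>The curvature tensor\<close>

definition comm :: "real^'n^'n \<Rightarrow> real^'n^'n \<Rightarrow> real^'n^'n" where
  "comm A B = A ** B - B ** A"

text \<open>The extension projects the constant matrix \<open>x\<close> onto each tangent space; for
  symmetric \<open>x\<close> this is a quadratic polynomial in the base point.\<close>

lemma odd_sym_extends_to_tangent_field:
  fixes Q :: "real^'n^'n"
  assumes Q: "Q \<in> Grass k" and x: "x \<in> odd_sym Q"
  shows "\<exists>X. tangent_field (Grass k) X \<and> X Q = x"
proof -
  define X where "X q = (1/2) *\<^sub>R (x - q ** x ** q)" for q
  \<comment> \<open>For fixed \<open>v\<close> the derivative \<open>L v\<close> is linear in
    \<open>q\<close>, so smoothness follows after a single differentiation.\<close>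
  define L where "L v q = - (1/2) *\<^sub>R (q ** x ** v + v ** x ** q)" for v q
  have dX: "(X has_derivative (\<lambda>v. L v q)) (at q)" for q
    unfolding X_def L_def
    by (auto intro!: derivative_eq_intros mm.FDERIV simp: mm_distribs mm.zero_right algebra_simps)
  have "bounded_linear (L v)" for v
    unfolding L_def linear_conv_bounded_linear[symmetric]
    by (rule linearI) (simp_all add: mm_distribs algebra_simps)
  moreover have "(\<lambda>q. frechet_derivative X (at q) v) = L v" for v
  proof
    fix q
    show "frechet_derivative X (at q) v = L v q"
      using fun_cong[OF frechet_derivative_at[OF dX[of q]], of v] by simp
  qed
  moreover have "X differentiable (at q)" for q
    using dX unfolding differentiable_def by blast
  ultimately have "smooth_map X"
    by - (rule smooth_mapI, simp_all add: smooth_map_bounded_linear)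
  moreover have "X q \<in> odd_sym q" if "q \<in> Grass k" for q
  proof -
    have "X q = odd_proj q x"
      by (simp add: X_def odd_proj_def odd_symD(1)[OF x] mm_distribs flip: scaleR_2)
         (simp add: scaleR_diff_right)
    then show ?thesis using odd_proj_in[OF that] by simp
  qed
  moreover have "X Q = x"
  proof -
    have "Q ** x ** Q = - x"
      by (simp add: odd_symD(3)[OF x] mm_distribs GrassD[OF Q] flip: matrix_mul_assoc)
    then show ?thesis by (simp add: X_def flip: scaleR_2)
  qed
  ultimately show ?thesis
    by (auto simp: tangent_field_def tangent_space_Grass)
qed

section \<open>The Levi-Civita connection on smooth tangent fields\<close>

context
  fixes k :: nat and Q :: "real^'n^'n"
  assumes Q: "Q \<in> Grass k"
begin

lemma tangent_field_in_odd_sym: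
  assumes "tangent_field (Grass k) Z" "q \<in> Grass k"
  shows "Z q \<in> odd_sym q"
  using assms by (auto simp: tangent_field_def tangent_space_Grass)

lemma tangent_field_frechet_derivative:
  assumes "tangent_field (Grass k) Z"
  shows "(Z has_derivative frechet_derivative Z (at q)) (at q within S)"
  using assms by (auto simp: tangent_field_def intro: has_derivative_at_withinI smooth_map_frechet_derivative)

lemma dir_deriv_tangent_field:
  assumes "tangent_field (Grass k) Z" "v \<in> odd_sym Q"
  shows "dir_deriv (Grass k) Z Q v = frechet_derivative Z (at Q) v"
  using dir_deriv_eq[OF tangent_field_frechet_derivative[OF assms(1)]] assms(2)
  by (simp add: tangent_space_Grass[OF Q])

text \<open>Both equations are derivatives of the tangency conditions on \<open>Z\<close>. The
  second fixes the part of \<open>a\<close> commuting with \<open>Q\<close> by the values of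
  \<open>Z\<close> and \<open>v\<close> alone.\<close>

lemma tangent_field_derivative:
  assumes Z: "tangent_field (Grass k) Z" and v: "v \<in> odd_sym Q"
  defines "a \<equiv> frechet_derivative Z (at Q) v"
  shows "transpose a = a" "a ** Q + Q ** a = - (Z Q ** v + v ** Z Q)"
proof -
  let ?D = "frechet_derivative Z (at Q)"
  \<comment> \<open>A map vanishing on the manifold has zero derivative in tangent
    directions.\<close>
  have zero: "f' v = 0" if "(f has_derivative f') (at Q within Grass k)" "\<And>q. q \<in> Grass k \<Longrightarrow> f q = 0"
    for f f' :: "real^'n^'n \<Rightarrow> real^'n^'n"
  proof (rule has_derivative_within_tangent_unique[OF that(1)])
    show "(f has_derivative (\<lambda>_. 0)) (at Q within Grass k)"
      by (rule has_derivative_transform[OF Q _ has_derivative_const]) (rule that(2))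
    show "v \<in> tangent_space (Grass k) Q" using v by (simp add: tangent_space_Grass[OF Q])
  qed
  note D = tangent_field_frechet_derivative[OF Z, of Q "Grass k"]
  have "transpose (?D v) - ?D v = 0"
    by (rule zero[OF has_derivative_diff[OF bounded_linear.has_derivative[OF bounded_linear_transpose D] D]])
       (use tangent_field_in_odd_sym[OF Z] odd_symD(1) in force)
  then show "transpose a = a" by (simp add: a_def)
  have "Z Q ** v + ?D v ** Q + (Q ** ?D v + v ** Z Q) = 0"
    by (rule zero[OF has_derivative_add[OF mm.FDERIV[OF D has_derivative_ident] mm.FDERIV[OF has_derivative_ident D]]])
       (use tangent_field_in_odd_sym[OF Z] odd_symD(2) in force)
  then show "a ** Q + Q ** a = - (Z Q ** v + v ** Z Q)"
    unfolding a_def eq_neg_iff_add_eq_0 by (simp add: ac_simps)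
qed

text \<open>The tangential part of the symmetric matrix \<open>a\<close> is (a - QaQ)/2, and the
  anticommutator relation expresses QaQ through \<open>a\<close> and the field values. The
  correction term is minus the second fundamental form.\<close>

lemma conn_Grass:
  assumes Y: "tangent_field (Grass k) Y" and Z: "tangent_field (Grass k) Z"
  shows "conn (Grass k) Y Z Q
    = frechet_derivative Z (at Q) (Y Q) + (1/2) *\<^sub>R ((Z Q ** Y Q + Y Q ** Z Q) ** Q)"
proof -
  have Yt: "Y Q \<in> odd_sym Q" by (rule tangent_field_in_odd_sym[OF Y Q])
  let ?a = "frechet_derivative Z (at Q) (Y Q)"
  note a = tangent_field_derivative[OF Z Yt]
  have "Q ** ?a ** Q = - (Z Q ** Y Q + Y Q ** Z Q) ** Q - ?a ** Q ** Q"
    unfolding a(2)[symmetric] by (simp add: mm_distribs)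
  also have "?a ** Q ** Q = ?a" by (simp add: GrassD[OF Q] flip: matrix_mul_assoc)
  finally have *: "Q ** ?a ** Q = - ((Z Q ** Y Q + Y Q ** Z Q) ** Q) - ?a" by (simp add: mm_distribs)
  have "conn (Grass k) Y Z Q = odd_proj Q ?a"
    by (simp add: conn_def dir_deriv_tangent_field[OF Z Yt] tproj_Grass[OF Q])
  also have "\<dots> = (1/2) *\<^sub>R (?a - Q ** ?a ** Q)"
    unfolding odd_proj_def a(1) by (simp add: mm_distribs flip: scaleR_2) (simp add: scaleR_diff_right)
  finally show ?thesis unfolding * by (simp add: algebra_simps flip: scaleR_2)
qed

text \<open>The two derivatives have the same anticommutator with \<open>Q\<close>, so their
  difference is tangent.\<close>

lemma lie_bracket_Grass:
  assumes X: "tangent_field (Grass k) X" and Y: "tangent_field (Grass k) Y"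
  shows "lie_bracket (Grass k) X Y Q
      = frechet_derivative Y (at Q) (X Q) - frechet_derivative X (at Q) (Y Q)"
    and "lie_bracket (Grass k) X Y Q \<in> odd_sym Q"
proof -
  have t: "X Q \<in> odd_sym Q" "Y Q \<in> odd_sym Q"
    using tangent_field_in_odd_sym Q X Y by auto
  show *: "lie_bracket (Grass k) X Y Q
      = frechet_derivative Y (at Q) (X Q) - frechet_derivative X (at Q) (Y Q)"
    by (simp add: lie_bracket_def dir_deriv_tangent_field X Y t)
  note dY = tangent_field_derivative[OF Y t(1)] and dX = tangent_field_derivative[OF X t(2)]
  have "(A - B) ** Q + Q ** (A - B) = (A ** Q + Q ** A) - (B ** Q + Q ** B)" for A B
    by (simp add: mm_distribs)
  then show "lie_bracket (Grass k) X Y Q \<in> odd_sym Q"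
    unfolding * odd_sym_def by (simp add: transpose_linear dX dY add.commute[of "X Q ** Y Q"])
qed

end

text \<open>Conjugation by \<open>Q\<close> is an isometry sending \<open>w\<close> to
  \<open>- w\<close>, so \<open>w\<close> detects only the part of \<open>M\<close> that changes
  sign under it.\<close>

lemma inner_odd_part:
  assumes Q: "Q \<in> Grass k" and w: "w \<in> odd_sym Q"
  shows "inner M w = (1/2) * inner (M - Q ** M ** Q) w"
proof -
  have *: "Q ** w ** Q = - w"
    by (simp add: odd_symD(3)[OF w] mm_distribs GrassD[OF Q] flip: matrix_mul_assoc)
  have "inner (Q ** M ** Q) w = - inner M w"
    by (simp only: inner_matrix_mult_right[of "Q ** _"] inner_matrix_mult_left[of Q]
        matrix_mul_assoc GrassD[OF Q] * inner_minus_right)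
  then show ?thesis by (simp add: inner_diff_left)
qed

text \<open>A product of two matrices anticommuting with \<open>Q\<close> commutes with
  \<open>Q\<close>, hence conjugation by \<open>Q\<close> fixes \<open>A ** B ** Q\<close>.\<close>

lemma inner_odd_even_zero:
  assumes Q: "Q \<in> Grass k" and "w \<in> odd_sym Q" "A \<in> odd_sym Q" "B \<in> odd_sym Q"
  shows "inner (A ** B ** Q) w = 0"
proof -
  have "Q ** (A ** B ** Q) ** Q = Q ** A ** B"
    by (simp add: GrassD[OF Q] flip: matrix_mul_assoc)
  also have "\<dots> = - (A ** (Q ** B))" by (simp add: odd_symD(3)[OF assms(3)] mm_distribs matrix_mul_assoc)
  also have "\<dots> = A ** B ** Q" by (simp add: odd_symD(3)[OF assms(4)] mm_distribs matrix_mul_assoc)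
  finally show ?thesis using inner_odd_part[OF Q assms(2), of "A ** B ** Q"] by simp
qed

text \<open>Here \<open>a\<close> will be a derivative of \<open>Z\<close>, which depends on the
  extension. Only its anticommutator with \<open>Q\<close> survives, and that depends on values at
  \<open>Q\<close>.\<close>

lemma inner_odd_anticommutator:
  assumes Q: "Q \<in> Grass k" and "w \<in> odd_sym Q" "y \<in> odd_sym Q"
    and a: "a ** Q + Q ** a = - N"
  shows "inner ((a ** y + y ** a) ** Q) w = (1/2) * inner (N ** y - y ** N) w"
proof -
  let ?M = "(a ** y + y ** a) ** Q"
  have N: "N = - (a ** Q) - Q ** a"
  proof -
    have "N = - (a ** Q + Q ** a)" by (simp only: a minus_minus)
    then show ?thesis by simp
  qed
  have yQ: "Q ** y = - (y ** Q)" by (rule odd_symD[OF assms(3)])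
  have "Q ** ?M ** Q = Q ** (a ** y + y ** a)"
    by (simp add: GrassD[OF Q] flip: matrix_mul_assoc)
  also have "\<dots> = Q ** a ** y + (Q ** y) ** a" by (simp add: mm_distribs matrix_mul_assoc)
  finally have "?M - Q ** ?M ** Q = N ** y - y ** N"
    unfolding N by (simp add: mm_distribs yQ flip: matrix_mul_assoc)
  then show ?thesis using inner_odd_part[OF Q assms(2), of ?M] by simp
qed

text \<open>Differentiating the connection formula leaves three kinds of derivative terms: second
  derivatives of \<open>Z\<close> cancel by symmetry, derivatives of \<open>X\<close> and
  \<open>Y\<close> combine into the bracket, and first derivatives of \<open>Z\<close> are removed
  by the anticommutator identity.\<close>

lemma inner_curv_field_Grass:
  fixes Q :: "real^'n^'n"
  assumes Q: "Q \<in> Grass k"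
    and X: "tangent_field (Grass k) X" and Y: "tangent_field (Grass k) Y"
    and Z: "tangent_field (Grass k) Z" and w: "w \<in> odd_sym Q"
  shows "inner (curv_field (Grass k) X Y Z Q) w = (1/4) * inner (comm (comm (X Q) (Y Q)) (Z Q)) w"
proof -
  let ?x = "X Q" and ?y = "Y Q" and ?z = "Z Q"
  let ?DX = "frechet_derivative X (at Q)" and ?DY = "frechet_derivative Y (at Q)"
    and ?DZ = "frechet_derivative Z (at Q)"
  note fields = X Y Z
  have smooth: "smooth_map X" "smooth_map Y" "smooth_map Z"
    using fields by (simp_all add: tangent_field_def)
  have x: "?x \<in> odd_sym Q" and y: "?y \<in> odd_sym Q" and z: "?z \<in> odd_sym Q"
    using fields Q by (simp_all add: tangent_field_in_odd_sym)
  have second: "inner (conn (Grass k) U (conn (Grass k) V Z) Q) w =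
      inner (iter_dderiv [U Q, V Q] Z Q) w + inner (?DZ (frechet_derivative V (at Q) (U Q))) w
      + (1/2) * (inner ((?z ** V Q + V Q ** ?z) ** U Q) w
        + inner ((?z ** frechet_derivative V (at Q) (U Q) + frechet_derivative V (at Q) (U Q) ** ?z) ** Q) w
        + inner ((?DZ (U Q) ** V Q + V Q ** ?DZ (U Q)) ** Q) w)"
    if U: "tangent_field (Grass k) U" and V: "tangent_field (Grass k) V" for U V
  proof -
    have sV: "smooth_map V" using V by (simp add: tangent_field_def)
    let ?DV = "frechet_derivative V (at Q)"
    let ?F = "\<lambda>q. frechet_derivative Z (at q) (V q) + (1/2) *\<^sub>R ((Z q ** V q + V q ** Z q) ** q)"
    let ?F' = "\<lambda>h. (iter_dderiv [h, V Q] Z Q + ?DZ (?DV h))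
      + (1/2) *\<^sub>R ((?z ** V Q + V Q ** ?z) ** h + ((?z ** ?DV h + ?DZ h ** V Q) + (V Q ** ?DZ h + ?DV h ** ?z)) ** Q)"
    note dV = smooth_map_frechet_derivative[OF sV, of Q] and dZ = smooth_map_frechet_derivative[OF smooth(3), of Q]
    have "(?F has_derivative ?F') (at Q)"
      by (rule has_derivative_add[OF has_derivative_directional_derivative[OF sV smooth(3)]
          has_derivative_scaleR_right[OF mm.FDERIV[OF has_derivative_add[OF mm.FDERIV[OF dZ dV] mm.FDERIV[OF dV dZ]]
          has_derivative_ident]]])
    \<comment> \<open>The connection agrees with \<open>?F\<close> on the manifold only, so its
      derivative is taken within that set.\<close>
    then have "(conn (Grass k) V Z has_derivative ?F') (at Q within Grass k)"
      by (intro has_derivative_transform[OF Q conn_Grass[OF _ V Z] has_derivative_at_withinI])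
    moreover have Ut: "U Q \<in> tangent_space (Grass k) Q"
      using U Q by (simp add: tangent_field_def)
    ultimately have "dir_deriv (Grass k) (conn (Grass k) V Z) Q (U Q) = ?F' (U Q)"
      by (rule dir_deriv_eq)
    \<comment> \<open>Pairing with the tangent vector \<open>w\<close> makes the outer projection
      disappear.\<close>
    then have "inner (conn (Grass k) U (conn (Grass k) V Z) Q) w = inner (?F' (U Q)) w"
      unfolding conn_def[of _ U] by (simp add: tproj_Grass[OF Q] inner_odd_proj[OF Q w])
    then show ?thesis by (simp add: inner_add_left mm_distribs algebra_simps)
  qed
  define B where "B = lie_bracket (Grass k) X Y Q"
  have B: "B = ?DY ?x - ?DX ?y" "B \<in> odd_sym Q"
    unfolding B_def using lie_bracket_Grass[OF Q X Y] by auto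
  have third: "inner (conn (Grass k) (lie_bracket (Grass k) X Y) Z Q) w = inner (?DZ B) w"
    unfolding conn_def B_def[symmetric]
    by (simp add: dir_deriv_tangent_field[OF Q Z B(2)] tproj_Grass[OF Q] inner_odd_proj[OF Q w])
  have linZ: "?DZ B = ?DZ (?DY ?x) - ?DZ (?DX ?y)"
    unfolding B(1)
    by (rule linear_diff[OF has_derivative_linear[OF smooth_map_frechet_derivative[OF smooth(3)]]])
  \<comment> \<open>The derivatives of \<open>X\<close> and \<open>Y\<close> enter through the
    tangent vector \<open>B\<close>; its products with \<open>?z\<close>, multiplied by
    \<open>Q\<close>, are orthogonal to \<open>w\<close>.\<close>
  have BQ: "inner ((?z ** ?DY ?x + ?DY ?x ** ?z) ** Q) w - inner ((?z ** ?DX ?y + ?DX ?y ** ?z) ** Q) w = 0"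
  proof -
    have "(?z ** ?DY ?x + ?DY ?x ** ?z) ** Q - (?z ** ?DX ?y + ?DX ?y ** ?z) ** Q = ?z ** B ** Q + B ** ?z ** Q"
      unfolding B(1) by (simp add: mm_distribs)
    then show ?thesis
      unfolding inner_diff_left[symmetric]
      by (simp add: inner_add_left inner_odd_even_zero[OF Q w z B(2)] inner_odd_even_zero[OF Q w B(2) z])
  qed
  note ac = inner_odd_anticommutator[OF Q w y tangent_field_derivative(2)[OF Q Z x]]
    inner_odd_anticommutator[OF Q w x tangent_field_derivative(2)[OF Q Z y]]
  have "inner (curv_field (Grass k) X Y Z Q) w =
      (1/2) * (inner ((?z ** ?y + ?y ** ?z) ** ?x) w - inner ((?z ** ?x + ?x ** ?z) ** ?y) w
        + inner ((?DZ ?x ** ?y + ?y ** ?DZ ?x) ** Q) w - inner ((?DZ ?y ** ?x + ?x ** ?DZ ?y) ** Q) w)"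
    unfolding curv_field_def inner_diff_left second[OF X Y] second[OF Y X] third linZ
    using BQ iter_dderiv_commute[OF smooth(3), of ?x ?y Q] by (simp add: algebra_simps)
  also have "\<dots> = (1/4) * inner (comm (comm ?x ?y) ?z) w"
    unfolding ac comm_def
    by (simp add: mm_distribs inner_add_left inner_diff_left matrix_mul_assoc algebra_simps)
  finally show ?thesis .
qed

text \<open>Extensions exist and every choice yields the same value, so the choice operator in
  \<open>Rm\<close> is resolved.\<close>

lemma Rm_Grass:
  assumes Q: "Q \<in> Grass k"
    and xyz: "x \<in> odd_sym Q" "y \<in> odd_sym Q" "z \<in> odd_sym Q" and w: "w \<in> odd_sym Q"
  shows "Rm (Grass k) Q x y z w = (1/4) * inner (comm (comm x y) z) w"
  unfolding Rm_def
proof (rule someI2_ex)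
  obtain X Y Z where "tangent_field (Grass k) X" "tangent_field (Grass k) Y" "tangent_field (Grass k) Z"
    "X Q = x" "Y Q = y" "Z Q = z"
    using odd_sym_extends_to_tangent_field[OF Q] xyz by metis
  then show "\<exists>c X Y Z. tangent_field (Grass k) X \<and> tangent_field (Grass k) Y \<and> tangent_field (Grass k) Z \<and>
        X Q = x \<and> Y Q = y \<and> Z Q = z \<and> c = inner (curv_field (Grass k) X Y Z Q) w"
    by blast
qed (use inner_curv_field_Grass[OF Q _ _ _ w] in blast)

lemma inner_comm_skew:
  assumes "transpose x = x" "transpose y = y"
  shows "inner (comm (comm x y) y) x = inner (comm x y) (comm x y)"
proof -
  have "inner (comm x y ** y) x = inner (comm x y) (x ** y)"
    "inner (y ** comm x y) x = inner (comm x y) (y ** x)"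
    using assms by (simp_all only: inner_matrix_mult_right[of "comm x y"] inner_matrix_mult_left[of y])
  then show ?thesis unfolding comm_def[of "comm x y"] inner_diff_left
    by (simp add: comm_def[of x y] inner_diff_right)
qed

lemma Rm_Grass_sectional:
  assumes "Q \<in> Grass k" "x \<in> odd_sym Q" "y \<in> odd_sym Q"
  shows "Rm (Grass k) Q x y y x = (1/4) * inner (comm x y) (comm x y)"
  using assms by (simp add: Rm_Grass inner_comm_skew odd_symD(1))

section \<open>Ricci and scalar curvature\<close>

lemma onb_norm_inner:
  assumes "onb V B" "a \<in> B" "b \<in> B"
  shows "inner a b = (if a = b then 1 else 0)"
proof -
  have "inner a a = 1" using assms by (simp add: onb_def norm_eq_1)
  moreover have "inner a b = 0" if "a \<noteq> b"
    using assms that unfolding onb_def pairwise_def orthogonal_def by blast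
  ultimately show ?thesis by auto
qed

lemma onb_finite:
  assumes "onb V B"
  shows "finite B"
proof -
  have "independent B"
    by (rule pairwise_orthogonal_independent) (use assms in \<open>auto simp: onb_def\<close>)
  then show ?thesis by (rule independent_imp_finite)
qed

lemma onb_expand: "onb V B \<Longrightarrow> v \<in> V \<Longrightarrow> (\<Sum>b\<in>B. inner v b *\<^sub>R b) = v"
  using onb_finite[of V B] by (intro orthonormal_basis_expand) (auto simp: onb_def)

lemma onb_inner:
  assumes "onb V B" "v \<in> V"
  shows "inner v u = (\<Sum>b\<in>B. inner v b * inner u b)"
proof -
  have "inner v u = inner (\<Sum>b\<in>B. inner v b *\<^sub>R b) u" by (simp add: onb_expand[OF assms])
  then show ?thesis by (simp add: inner_sum_left inner_commute[of u])
qed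

lemma onb_exists: "subspace V \<Longrightarrow> \<exists>B. onb V B"
  using orthonormal_basis_subspace[of V] unfolding onb_def by metis

lemma onb_span:
  assumes "pairwise orthogonal B" "\<And>b. b \<in> B \<Longrightarrow> norm b = 1"
  shows "onb (span B) B"
  using assms by (auto simp: onb_def span_base)

lemma bessel_inequality:
  fixes u :: "'a::euclidean_space"
  assumes "pairwise orthogonal B" "\<And>b. b \<in> B \<Longrightarrow> norm b = 1"
  shows "(\<Sum>b\<in>B. (inner u b)\<^sup>2) \<le> inner u u"
proof -
  note B = onb_span[OF assms]
  define p where "p = (\<Sum>b\<in>B. inner u b *\<^sub>R b)"
  have p: "p \<in> span B" unfolding p_def by (intro span_sum span_scale span_base)
  have pb: "inner p b = inner u b" if "b \<in> B" for b
  proof -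
    have "inner p b = (\<Sum>a\<in>B. if a = b then inner u a else 0)"
      unfolding p_def inner_sum_left
      by (rule sum.cong) (auto simp: onb_norm_inner[OF B _ that])
    then show ?thesis using onb_finite[OF B] that by simp
  qed
  have "inner p p = (\<Sum>b\<in>B. (inner u b)\<^sup>2)" "inner p u = (\<Sum>b\<in>B. (inner u b)\<^sup>2)"
    using onb_inner[OF B p, of p] onb_inner[OF B p, of u] pb
    by (simp_all add: power2_eq_square cong: sum.cong)
  moreover have "0 \<le> inner (u - p) (u - p)" by simp
  ultimately show ?thesis by (simp add: inner_diff inner_commute[of u p])
qed

lemma mult_if_zero:
  "(if P then x else 0) * y = (if P then x * y else (0::real))"
  "y * (if P then x else 0) = (if P then y * x else (0::real))"
  "(\<Sum>a\<in>A. if P then f a else 0) = (if P then sum f A else (0::real))"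
  by auto

text \<open>Conjugation by \<open>Q\<close> preserves the trace and negates \<open>x\<close>. For
  \<open>Q ** x\<close>, cyclicity of the trace meets the anticommutation relation.\<close>

lemma trace_odd_sym:
  fixes Q :: "real^'n^'n"
  assumes Q: "Q \<in> Grass k" and x: "x \<in> odd_sym Q"
  shows "trace x = 0" "trace (Q ** x) = 0"
proof -
  have neg: "trace (- A) = - trace A" for A :: "real^'n^'n"
    by (simp add: trace_def sum_negf)
  have "trace (Q ** (x ** Q)) = trace (x ** Q ** Q)" by (rule trace_mul_sym)
  also have "x ** Q ** Q = x" by (simp add: GrassD[OF Q] flip: matrix_mul_assoc)
  also have "Q ** (x ** Q) = - x"
    by (simp add: odd_symD(2)[OF x] mm_distribs matrix_mul_assoc GrassD[OF Q])
  finally show "trace x = 0" by (simp add: neg)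
  have "trace (Q ** x) = trace (x ** Q)" by (rule trace_mul_sym)
  also have "x ** Q = - (Q ** x)" by (rule odd_symD[OF x])
  finally show "trace (Q ** x) = 0" by (simp add: neg)
qed

text \<open>By Parseval the sum is the inner product of the projected matrix unit
  \<open>E i j\<close> with \<open>E a b\<close>, an entry of \<open>odd_proj\<close>. The three
  lemmas that follow contract indices in this identity.\<close>

lemma sum_onb_odd_sym_entries:
  fixes Q :: "real^'n^'n"
  assumes Q: "Q \<in> Grass k" and B: "onb (odd_sym Q) B"
  shows "(\<Sum>e\<in>B. e $ i $ j * e $ a $ b) = (1/4) * ((mat 1 :: real^'n^'n) $ i $ a * (mat 1 :: real^'n^'n) $ j $ b
    + (mat 1 :: real^'n^'n) $ j $ a * (mat 1 :: real^'n^'n) $ i $ b - Q $ a $ i * Q $ j $ b - Q $ a $ j * Q $ i $ b)"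
proof -
  define E :: "'n \<Rightarrow> 'n \<Rightarrow> real^'n^'n" where "E i j = (\<chi> a b. if a = i then if b = j then 1 else 0 else 0)" for i j
  have E: "inner M (E i j) = M $ i $ j" for M i j
    by (simp add: inner_matrix_eq_sum E_def mult_if_zero)
  have "(\<Sum>e\<in>B. e $ i $ j * e $ a $ b) = (\<Sum>e\<in>B. inner (odd_proj Q (E i j)) e * inner (E a b) e)"
  proof (rule sum.cong[OF refl])
    fix e assume "e \<in> B"
    then have e: "e \<in> odd_sym Q" using B by (auto simp: onb_def)
    show "e $ i $ j * e $ a $ b = inner (odd_proj Q (E i j)) e * inner (E a b) e"
      unfolding inner_odd_proj[OF Q e] by (simp add: E inner_commute[of "E _ _"])
  qed
  also have "\<dots> = odd_proj Q (E i j) $ a $ b"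
    by (simp add: onb_inner[OF B odd_proj_in[OF Q], symmetric] E)
  also have "\<dots> = (1/4) * ((mat 1 :: real^'n^'n) $ i $ a * (mat 1 :: real^'n^'n) $ j $ b
    + (mat 1 :: real^'n^'n) $ j $ a * (mat 1 :: real^'n^'n) $ i $ b - Q $ a $ i * Q $ j $ b - Q $ a $ j * Q $ i $ b)"
    by (simp add: odd_proj_def transpose_def E_def matrix_matrix_mult_def mat_def
        mult_if_zero distrib_left distrib_right sum.distrib)
  finally show ?thesis .
qed

text \<open>The dimension is the trace of the projection. The contraction gives (n^2 - (tr Q)^2)/4,
  where tr Q = 2k - n.\<close>

lemma card_onb_odd_sym:
  fixes Q :: "real^'n^'n"
  assumes Q: "Q \<in> Grass k" and B: "onb (odd_sym Q) B"
  shows "real (card B) = real k * (real CARD('n) - real k)"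
proof -
  have QQ: "(\<Sum>i\<in>UNIV. \<Sum>j\<in>UNIV. Q $ i $ j * Q $ j $ i) = real CARD('n)"
  proof -
    have "trace (Q ** Q) = real CARD('n)" by (simp add: GrassD[OF Q] trace_I)
    then show ?thesis by (simp add: trace_def matrix_matrix_mult_def)
  qed
  have "real (card B) = (\<Sum>e\<in>B. inner e e)"
    using onb_norm_inner[OF B] by simp
  also have "\<dots> = (\<Sum>i\<in>UNIV. \<Sum>j\<in>UNIV. \<Sum>e\<in>B. e $ i $ j * e $ i $ j)"
    unfolding inner_matrix_eq_sum by (simp add: sum.swap[of _ B])
  also have "\<dots> = (1/4) * ((\<Sum>i\<in>(UNIV::'n set). \<Sum>j\<in>(UNIV::'n set). (1::real)) + (\<Sum>i\<in>UNIV. \<Sum>j\<in>UNIV. (mat 1 :: real^'n^'n) $ j $ i * (mat 1 :: real^'n^'n) $ i $ j)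
      - (\<Sum>i\<in>UNIV. \<Sum>j\<in>UNIV. Q $ i $ i * Q $ j $ j) - (\<Sum>i\<in>UNIV. \<Sum>j\<in>UNIV. Q $ i $ j * Q $ i $ j))"
    unfolding sum_onb_odd_sym_entries[OF Q B]
    by (simp add: sum_distrib_left[symmetric] sum.distrib sum_subtractf mat_def sum_divide_distrib[symmetric])
  also have "(\<Sum>i\<in>UNIV. \<Sum>j\<in>UNIV. (mat 1 :: real^'n^'n) $ j $ i * (mat 1 :: real^'n^'n) $ i $ j) = real CARD('n)"
    by (simp add: mat_def mult_if_zero)
  also have "(\<Sum>i\<in>UNIV. \<Sum>j\<in>UNIV. Q $ i $ i * Q $ j $ j) = (trace Q)\<^sup>2"
    by (simp add: trace_def power2_eq_square sum_product)
  also have "(\<Sum>i\<in>UNIV. \<Sum>j\<in>UNIV. Q $ i $ j * Q $ i $ j) = real CARD('n)"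
  proof -
    have "Q $ i $ j = Q $ j $ i" for i j
      using GrassD(1)[OF Q] by (metis transpose_def vec_lambda_beta)
    with QQ show ?thesis by (metis (no_types, lifting) sum.cong)
  qed
  finally show ?thesis
    by (simp add: GrassD[OF Q] power2_eq_square field_simps)
qed

lemma sum_onb_odd_sym_squares:
  fixes Q :: "real^'n^'n"
  assumes Q: "Q \<in> Grass k" and B: "onb (odd_sym Q) B"
  shows "(\<Sum>e\<in>B. e ** e) = (1/4) *\<^sub>R (real CARD('n) *\<^sub>R mat 1 - trace Q *\<^sub>R Q)"
proof -
  have "(\<Sum>e\<in>B. e ** e) $ i $ l = (1/4) * (real CARD('n) * (mat 1 :: real^'n^'n) $ i $ l - trace Q * Q $ i $ l)" for i l
  proof -
    have sym: "Q $ j $ i = Q $ i $ j" for j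
      using GrassD(1)[OF Q] by (metis transpose_def vec_lambda_beta)
    have QQ: "(\<Sum>j\<in>UNIV. Q $ i $ j * Q $ j $ l) = (mat 1 :: real^'n^'n) $ i $ l"
      using arg_cong[OF GrassD(2)[OF Q], of "\<lambda>M. M $ i $ l"] by (simp add: matrix_matrix_mult_def)
    have "(\<Sum>e\<in>B. e ** e) $ i $ l = (\<Sum>j\<in>UNIV. \<Sum>e\<in>B. e $ i $ j * e $ j $ l)"
      by (simp add: matrix_matrix_mult_def sum.swap[of _ B])
    also have "\<dots> = (1/4) * ((\<Sum>j\<in>UNIV. (mat 1 :: real^'n^'n) $ i $ j * (mat 1 :: real^'n^'n) $ j $ l)
       + real CARD('n) * (mat 1 :: real^'n^'n) $ i $ l - (\<Sum>j\<in>UNIV. Q $ i $ j * Q $ j $ l) - trace Q * Q $ i $ l)"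
      unfolding sum_onb_odd_sym_entries[OF Q B] sym
      by (simp add: sum_distrib_left[symmetric] sum_distrib_right[symmetric] sum.distrib sum_subtractf
          mat_def sum_divide_distrib[symmetric] trace_def)
    also have "(\<Sum>j\<in>UNIV. (mat 1 :: real^'n^'n) $ i $ j * (mat 1 :: real^'n^'n) $ j $ l) = (mat 1 :: real^'n^'n) $ i $ l"
      by (simp add: mat_def mult_if_zero)
    finally show ?thesis using QQ by simp
  qed
  then show ?thesis by (simp add: vec_eq_iff)
qed

text \<open>Of the four contracted terms, the two traces vanish, while \<open>x\<close> and -QxQ = x
  remain, with the common factor 1/4.\<close>

lemma sum_onb_odd_sym_conj:
  fixes Q :: "real^'n^'n"
  assumes Q: "Q \<in> Grass k" and B: "onb (odd_sym Q) B" and x: "x \<in> odd_sym Q"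
  shows "(\<Sum>e\<in>B. e ** x ** e) = (1/2) *\<^sub>R x"
proof -
  let ?I = "mat 1 :: real^'n^'n"
  have QxQ: "Q ** x ** Q = - x"
    by (simp add: odd_symD(3)[OF x] mm_distribs GrassD[OF Q] flip: matrix_mul_assoc)
  have "(\<Sum>e\<in>B. e ** x ** e) $ i $ l = (1/2) * x $ i $ l" for i l
  proof -
    have sym: "Q $ a $ b = Q $ b $ a" "x $ a $ b = x $ b $ a" for a b
      using GrassD(1)[OF Q] odd_symD(1)[OF x] by (metis transpose_def vec_lambda_beta)+
    have "(\<Sum>e\<in>B. e ** x ** e) $ i $ l = (\<Sum>e\<in>B. \<Sum>b\<in>UNIV. \<Sum>a\<in>UNIV. (e $ i $ a * e $ b $ l) * x $ a $ b)"
      by (simp add: matrix_matrix_mult_def sum_distrib_right sum_distrib_left mult_ac)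
    also have "\<dots> = (\<Sum>b\<in>UNIV. \<Sum>a\<in>UNIV. (\<Sum>e\<in>B. e $ i $ a * e $ b $ l) * x $ a $ b)"
      by (simp add: sum.swap[of _ B] sum_distrib_right)
    also have "\<dots> = (1/4) * ((\<Sum>b\<in>UNIV. \<Sum>a\<in>UNIV. ?I $ i $ b * ?I $ a $ l * x $ a $ b)
        + ?I $ i $ l * (\<Sum>b\<in>UNIV. \<Sum>a\<in>UNIV. ?I $ a $ b * x $ a $ b)
        - (\<Sum>b\<in>UNIV. \<Sum>a\<in>UNIV. Q $ b $ i * Q $ a $ l * x $ a $ b)
        - Q $ i $ l * (\<Sum>b\<in>UNIV. \<Sum>a\<in>UNIV. Q $ b $ a * x $ a $ b))"
      unfolding sum_onb_odd_sym_entries[OF Q B]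
      by (simp add: sum_distrib_left sum.distrib sum_subtractf algebra_simps sum_divide_distrib add_divide_distrib diff_divide_distrib)
    also have "(\<Sum>b\<in>UNIV. \<Sum>a\<in>UNIV. ?I $ i $ b * ?I $ a $ l * x $ a $ b) = x $ i $ l"
      unfolding sym(2)[of i l] by (simp add: mat_def mult_if_zero)
    also have "(\<Sum>b\<in>UNIV. \<Sum>a\<in>UNIV. ?I $ a $ b * x $ a $ b) = trace x"
      by (simp add: mat_def trace_def mult_if_zero)
    also have "(\<Sum>b\<in>UNIV. \<Sum>a\<in>UNIV. Q $ b $ i * Q $ a $ l * x $ a $ b) = (Q ** x ** Q) $ l $ i"
      unfolding matrix_matrix_mult_def by (simp add: sum_distrib_right sum_distrib_left sym(1)[of l] mult_ac)
    also have "(\<Sum>b\<in>UNIV. \<Sum>a\<in>UNIV. Q $ b $ a * x $ a $ b) = trace (Q ** x)"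
      by (simp add: trace_def matrix_matrix_mult_def)
    finally show ?thesis
      by (simp add: QxQ trace_odd_sym[OF Q x] sym(2)[of i l])
  qed
  then show ?thesis by (simp add: vec_eq_iff)
qed

text \<open>Each squared norm splits into a term with \<open>e ** e\<close> and a term with
  \<open>e ** x ** e\<close>, whose sums are known. The trace term drops out because
  \<open>x\<close> is orthogonal to \<open>x ** Q\<close>.\<close>

lemma sum_onb_odd_sym_comm:
  fixes Q :: "real^'n^'n"
  assumes Q: "Q \<in> Grass k" and B: "onb (odd_sym Q) B" and x: "x \<in> odd_sym Q"
  shows "(\<Sum>e\<in>B. inner (comm x e) (comm x e)) = (real CARD('n) - 2) / 2 * inner x x"
proof -
  have "inner (comm x e) (comm x e) = 2 * inner x (x ** (e ** e)) - 2 * inner x (e ** x ** e)" if "e \<in> B" for e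
  proof -
    have e: "transpose e = e" using that B odd_symD(1) by (auto simp: onb_def)
    have xs: "transpose x = x" using odd_symD(1)[OF x] .
    have 1: "inner (x ** e) (x ** e) = inner x (x ** (e ** e))"
      by (simp only: inner_matrix_mult_right[of x e] e matrix_mul_assoc)
    have 2: "inner (e ** x) (e ** x) = inner (x ** e) (x ** e)"
      using inner_transpose[of "x ** e" "x ** e"] by (simp add: matrix_transpose_mul e xs)
    have 3: "inner (x ** e) (e ** x) = inner x (e ** x ** e)"
      by (simp only: inner_matrix_mult_right[of x e] e)
    show ?thesis
      using 1 2 3 by (simp add: comm_def inner_diff inner_commute)
  qed
  then have "(\<Sum>e\<in>B. inner (comm x e) (comm x e))
      = 2 * inner x (x ** (\<Sum>e\<in>B. e ** e)) - 2 * inner x (\<Sum>e\<in>B. e ** x ** e)"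
    by (simp add: sum_subtractf sum_distrib_left inner_sum_right mm.sum_right cong: sum.cong)
  also have "\<dots> = 2 * ((1/4) * (real CARD('n) * inner x x - trace Q * inner x (x ** Q))) - inner x x"
    unfolding sum_onb_odd_sym_squares[OF Q B] sum_onb_odd_sym_conj[OF Q B x]
    by (simp add: mm_distribs inner_diff_right)
  also have "inner x (x ** Q) = 0"
  proof -
    have "inner x (x ** Q) = inner x (Q ** x)"
      using inner_transpose[of x "x ** Q"] GrassD(1)[OF Q] odd_symD(1)[OF x]
      by (simp add: matrix_transpose_mul)
    also have "Q ** x = - (x ** Q)" by (rule odd_symD[OF x])
    finally show ?thesis by simp
  qed
  finally show ?thesis by (simp add: field_simps)
qed

lemma Ric_Grass:
  fixes Q :: "real^'n^'n"
  assumes Q: "Q \<in> Grass k" and x: "x \<in> odd_sym Q"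
  shows "Ric (Grass k) Q x x = (real CARD('n) - 2) / 8 * inner x x"
  unfolding Ric_def tangent_space_Grass[OF Q]
proof (rule someI2_ex)
  show "\<exists>c B. onb (odd_sym Q) B \<and> c = (\<Sum>e\<in>B. Rm (Grass k) Q x e e x)"
    using onb_exists[OF subspace_odd_sym] by blast
  fix c assume "\<exists>B. onb (odd_sym Q) B \<and> c = (\<Sum>e\<in>B. Rm (Grass k) Q x e e x)"
  then obtain B where B: "onb (odd_sym Q) B" and c: "c = (\<Sum>e\<in>B. Rm (Grass k) Q x e e x)" by blast
  have "c = (\<Sum>e\<in>B. (1/4) * inner (comm x e) (comm x e))"
    unfolding c by (rule sum.cong[OF refl], rule Rm_Grass_sectional[OF Q x]) (use B in \<open>auto simp: onb_def\<close>)
  then show "c = (real CARD('n) - 2) / 8 * inner x x"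
    by (simp only: sum_distrib_left[symmetric] sum_onb_odd_sym_comm[OF Q B x])
qed

lemma Scal_Grass:
  fixes Q :: "real^'n^'n"
  assumes Q: "Q \<in> Grass k"
  shows "Scal (Grass k) Q = real k * (real CARD('n) - real k) * (real CARD('n) - 2) / 8"
  unfolding Scal_def tangent_space_Grass[OF Q]
proof (rule someI2_ex)
  show "\<exists>c B. onb (odd_sym Q) B \<and> c = (\<Sum>e\<in>B. Ric (Grass k) Q e e)"
    using onb_exists[OF subspace_odd_sym] by blast
  fix c assume "\<exists>B. onb (odd_sym Q) B \<and> c = (\<Sum>e\<in>B. Ric (Grass k) Q e e)"
  then obtain B where B: "onb (odd_sym Q) B" and c: "c = (\<Sum>e\<in>B. Ric (Grass k) Q e e)" by blast
  have "c = (\<Sum>e\<in>B. (real CARD('n) - 2) / 8)"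
    unfolding c
  proof (rule sum.cong[OF refl])
    fix e assume e: "e \<in> B"
    then have "e \<in> odd_sym Q" using B by (auto simp: onb_def)
    from Ric_Grass[OF Q this] show "Ric (Grass k) Q e e = (real CARD('n) - 2) / 8"
      using onb_norm_inner[OF B e e] by simp
  qed
  then show "c = real k * (real CARD('n) - real k) * (real CARD('n) - 2) / 8"
    using card_onb_odd_sym[OF Q B] by simp
qed

section \<open>The commutator bound\<close>

text \<open>A maximiser \<open>e\<close> of the quadratic form on the unit sphere of
  \<open>S\<close> is an eigenvector: otherwise moving it towards the residual \<open>w\<close>
  would increase the Rayleigh quotient.\<close>

lemma selfadjoint_has_eigenvector:
  fixes f :: "'a::euclidean_space \<Rightarrow> 'a"
  assumes lin: "linear f" and sa: "\<And>u v. inner (f u) v = inner u (f v)"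
    and S: "subspace S" "f ` S \<subseteq> S" "S \<noteq> {0}"
  shows "\<exists>e\<in>S. norm e = 1 \<and> (\<exists>l. f e = l *\<^sub>R e)"
proof -
  obtain s where s: "s \<in> S" "s \<noteq> 0" using S subspace_0 by blast
  have unit: "(1 / norm v) *\<^sub>R v \<in> S \<inter> sphere 0 1" if "v \<in> S" "v \<noteq> 0" for v
    using that S by (simp add: subspace_scale)
  have "compact (S \<inter> sphere 0 1)"
    by (intro closed_Int_compact closed_subspace S compact_sphere)
  moreover have "S \<inter> sphere 0 1 \<noteq> {}" using unit[OF s] by blast
  moreover have "continuous_on (S \<inter> sphere 0 1) (\<lambda>v. inner v (f v))"
    by (intro continuous_intros linear_continuous_on linear_conv_bounded_linear[THEN iffD1] lin)
  ultimately obtain e where "e \<in> S \<inter> sphere 0 1"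
    and sup: "\<forall>v\<in>S \<inter> sphere 0 1. inner v (f v) \<le> inner e (f e)"
    using continuous_attains_sup[of "S \<inter> sphere 0 1" "\<lambda>v. inner v (f v)"] by blast
  then have e: "e \<in> S" "norm e = 1" by auto
  define \<mu> where "\<mu> = inner e (f e)"
  have ray: "inner v (f v) \<le> \<mu> * inner v v" if "v \<in> S" for v
  proof (cases "v = 0")
    case False
    have "inner ((1 / norm v) *\<^sub>R v) (f ((1 / norm v) *\<^sub>R v)) \<le> \<mu>"
      unfolding \<mu>_def using unit[OF that False] sup by blast
    then show ?thesis
      using False by (simp add: linear_scale[OF lin] dot_square_norm power2_eq_square field_simps)
  qed (simp add: linear_0[OF lin])
  define w where "w = f e - \<mu> *\<^sub>R e"
  have w: "w \<in> S" unfolding w_def using e S by (intro subspace_diff subspace_scale) auto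
  have we: "inner w e = 0"
    using e by (simp add: w_def \<mu>_def inner_diff_left inner_commute[of "f e"] norm_eq_1)
  have "f e = w + \<mu> *\<^sub>R e" by (simp add: w_def)
  then have wfe: "inner w (f e) = inner w w"
    using we by (simp add: inner_add_right)
  define c where "c = inner w (f w) - \<mu> * inner w w"
  have quad: "2 * t * inner w w + t\<^sup>2 * c \<le> 0" for t
  proof -
    have "inner (e + t *\<^sub>R w) (f (e + t *\<^sub>R w)) = \<mu> + 2 * t * inner w w + t\<^sup>2 * inner w (f w)"
      using wfe sa[of e w] by (simp add: linear_add[OF lin] linear_scale[OF lin] inner_add \<mu>_def
          power2_eq_square inner_commute[of "f e"] algebra_simps)
    moreover have "inner (e + t *\<^sub>R w) (e + t *\<^sub>R w) = 1 + t\<^sup>2 * inner w w"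
      using we e by (simp add: inner_add inner_commute[of e w] norm_eq_1 power2_eq_square)
    moreover have "e + t *\<^sub>R w \<in> S" using e w S by (intro subspace_add subspace_scale) auto
    ultimately show ?thesis using ray[of "e + t *\<^sub>R w"] by (simp add: c_def algebra_simps)
  qed
  have "inner w w = 0"
  proof (rule ccontr)
    assume "inner w w \<noteq> 0"
    then have pos: "inner w w > 0" by simp
    \<comment> \<open>This step is so small that the quadratic term, at worst -|w|^2 after division
      by \<open>t\<close>, cannot cancel 2|w|^2.\<close>
    define t where "t = inner w w / (\<bar>c\<bar> + 1)"
    have t: "t > 0" using pos by (simp add: t_def)
    have "2 * inner w w + t * c \<le> 0"
    proof -
      have "t * (2 * inner w w + t * c) \<le> 0" using quad[of t] by (simp add: power2_eq_square algebra_simps)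
      then show ?thesis using t by (simp add: mult_le_0_iff)
    qed
    moreover have "t * c \<ge> - inner w w"
    proof -
      have "t * \<bar>c\<bar> \<le> inner w w" using pos by (simp add: t_def field_simps)
      moreover have "- (t * \<bar>c\<bar>) \<le> t * c"
        using mult_left_mono[of "- \<bar>c\<bar>" c t] t by simp
      ultimately show ?thesis by linarith
    qed
    ultimately show False using pos by linarith
  qed
  then have "f e = \<mu> *\<^sub>R e" by (simp add: w_def)
  then show ?thesis using e by blast
qed

text \<open>Split off one eigenvector and recurse on its orthogonal complement in \<open>S\<close>,
  which self-adjointness keeps invariant.\<close>

lemma selfadjoint_eigenbasis:
  fixes f :: "'a::euclidean_space \<Rightarrow> 'a"
  assumes lin: "linear f" and sa: "\<And>u v. inner (f u) v = inner u (f v)"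
    and "subspace S" "f ` S \<subseteq> S"
  shows "\<exists>B. onb S B \<and> (\<forall>b\<in>B. \<exists>l. f b = l *\<^sub>R b)"
  using assms(3,4)
proof (induction "dim S" arbitrary: S rule: less_induct)
  case less
  show ?case
  proof (cases "S = {0}")
    case True
    then have "onb S {}" by (simp add: onb_def)
    then show ?thesis by blast
  next
    case False
    obtain e l where e: "e \<in> S" "norm e = 1" "f e = l *\<^sub>R e"
      using selfadjoint_has_eigenvector[OF lin sa less.prems False] by blast
    define T where "T = {v \<in> S. inner e v = 0}"
    have T: "subspace T"
      unfolding T_def using less.prems(1) by (auto simp: subspace_def inner_add_right)
    have "e \<notin> T" using e by (auto simp: T_def)
    moreover have "T \<subseteq> S" by (auto simp: T_def)
    ultimately have "T \<subset> S" using e(1) by blast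
    then have "dim T < dim S"
      using T less.prems(1) dim_subset[of T S] subspace_dim_equal[of T S]
      by (metis le_neq_implies_less order_refl psubset_imp_subset psubset_eq)
    moreover have "f ` T \<subseteq> T"
    proof -
      have "inner e (f v) = l * inner e v" for v
        using sa[of e v] e(3) by simp
      then show ?thesis using less.prems(2) by (auto simp: T_def)
    qed
    ultimately obtain B where B: "onb T B" "\<forall>b\<in>B. \<exists>l. f b = l *\<^sub>R b"
      using less.hyps[OF _ T] by blast
    have "span (insert e B) = S"
    proof
      show "span (insert e B) \<subseteq> S"
        by (rule span_minimal) (use B e less.prems in \<open>auto simp: onb_def T_def\<close>)
      show "S \<subseteq> span (insert e B)"
      proof
        fix v assume v: "v \<in> S"
        have "v - inner e v *\<^sub>R e \<in> T"
          unfolding T_def using v e less.prems(1)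
          by (simp add: subspace_diff subspace_scale inner_diff_right norm_eq_1)
        then have "v - inner e v *\<^sub>R e \<in> span B" using B by (simp add: onb_def)
        then show "v \<in> span (insert e B)" using span_breakdown_eq by blast
      qed
    qed
    then have "onb S (insert e B)"
      using B(1) e unfolding onb_def
      by (auto simp: T_def pairwise_insert orthogonal_def inner_commute)
    then show ?thesis using B(2) e by blast
  qed
qed

lemma inner_matrix_vector_mult: "inner (A *v u) v = inner u (transpose A *v v)" for A :: "real^'n^'n"
  using dot_lmul_matrix[of v A u]
  by (simp add: transpose_matrix_vector inner_commute[of u] inner_commute[of v])

lemma matrix_parseval:
  fixes M :: "real^'n^'n"
  assumes B: "onb UNIV B"
  shows "inner M M = (\<Sum>b\<in>B. \<Sum>a\<in>B. (inner a (M *v b))\<^sup>2)"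
proof -
  have "inner M M = (\<Sum>i\<in>UNIV. \<Sum>b\<in>B. (inner (M $ i) b)\<^sup>2)"
    unfolding inner_vec_def[of M M]
    by (rule sum.cong[OF refl], subst onb_inner[OF B UNIV_I]) (simp add: power2_eq_square)
  also have "\<dots> = (\<Sum>b\<in>B. inner (M *v b) (M *v b))"
    by (subst sum.swap) (simp add: inner_vec_def[of "M *v _"] matrix_vector_mul_component power2_eq_square)
  also have "\<dots> = (\<Sum>b\<in>B. \<Sum>a\<in>B. (inner a (M *v b))\<^sup>2)"
    by (rule sum.cong[OF refl], subst onb_inner[OF B UNIV_I])
       (simp add: power2_eq_square inner_commute[of "M *v _"])
  finally show ?thesis .
qed

text \<open>Bessel's inequality applied to each row. For orthonormal eigenvectors the left side is
  the sum of their squared eigenvalues.\<close>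

lemma matrix_bessel:
  fixes M :: "real^'n^'n"
  assumes "pairwise orthogonal S" "\<And>s. s \<in> S \<Longrightarrow> norm s = 1"
  shows "(\<Sum>s\<in>S. inner (M *v s) (M *v s)) \<le> inner M M"
proof -
  have "(\<Sum>s\<in>S. inner (M *v s) (M *v s)) = (\<Sum>i\<in>UNIV. \<Sum>s\<in>S. (inner (M $ i) s)\<^sup>2)"
    by (subst sum.swap) (simp add: inner_vec_def[of "M *v _"] matrix_vector_mul_component power2_eq_square)
  also have "\<dots> \<le> (\<Sum>i\<in>UNIV. inner (M $ i) (M $ i))"
    by (intro sum_mono bessel_inequality assms)
  finally show ?thesis by (simp add: inner_vec_def[of M M])
qed

section \<open>The spectrum of a tangent vector and the norm of a commutator\<close>

context
  fixes k :: nat and Q x :: "real^'n^'n"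
  assumes Q: "Q \<in> Grass k" and x: "x \<in> odd_sym Q"
begin

lemma inner_involution:
  "inner (Q *v u) v = inner u (Q *v v)" "inner (Q *v u) (Q *v v) = inner u v" "Q *v (Q *v u) = u"
  by (simp_all add: inner_matrix_vector_mult matrix_vector_mul_assoc GrassD[OF Q])

lemma inner_odd_selfadjoint: "inner (x *v u) v = inner u (x *v v)"
  by (simp add: inner_matrix_vector_mult odd_symD(1)[OF x])

lemma eigenvector_reflect:
  assumes "x *v e = l *\<^sub>R e"
  shows "x *v (Q *v e) = - l *\<^sub>R (Q *v e)"
proof -
  have "x *v (Q *v e) = - (Q ** x) *v e"
    by (simp add: matrix_vector_mul_assoc odd_symD(2)[OF x])
  also have "\<dots> = - (Q *v (x *v e))"
    by (simp add: matrix_vector_mul_assoc) (simp add: matrix_vector_mult_def vec_eq_iff sum_negf)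
  finally show ?thesis by (simp add: assms matrix_vector_mult_scaleR)
qed

lemma eigenvectors_orthogonal:
  assumes "x *v e = l *\<^sub>R e" "x *v f = m *\<^sub>R f" "l \<noteq> m"
  shows "inner e f = 0"
  using inner_odd_selfadjoint[of e f] assms by simp

text \<open>The vectors \<open>e\<close> and \<open>Q *v e\<close> are orthonormal eigenvectors for
  \<open>l\<close> and \<open>- l\<close>.\<close>

lemma eigenvalue_pair_le:
  assumes e: "norm e = 1" "x *v e = l *\<^sub>R e" and l: "l \<noteq> 0"
  shows "2 * l\<^sup>2 \<le> inner x x"
proof -
  have Qe: "x *v (Q *v e) = - l *\<^sub>R (Q *v e)" by (rule eigenvector_reflect[OF e(2)])
  have n: "inner e e = 1" "inner (Q *v e) (Q *v e) = 1"
    using e by (simp_all add: inner_involution norm_eq_1)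
  have o: "inner e (Q *v e) = 0"
    by (rule eigenvectors_orthogonal[OF e(2) Qe]) (use l in simp)
  then have "e \<noteq> Q *v e" using n by auto
  moreover have "(\<Sum>s\<in>{e, Q *v e}. inner (x *v s) (x *v s)) \<le> inner x x"
    by (rule matrix_bessel) (use n o in \<open>auto simp: pairwise_def orthogonal_def inner_commute norm_eq_1\<close>)
  ultimately show ?thesis using n by (simp add: e(2) Qe power2_eq_square)
qed

text \<open>Four orthonormal eigenvectors \<open>e\<close>, \<open>g\<close> and their images under
  \<open>Q\<close> enter Bessel's inequality. Stating orthogonality explicitly also covers repeated
  eigenvalues, such as \<open>m = - l\<close>.\<close>

lemma eigenvalue_quad_le:
  assumes e: "norm e = 1" "x *v e = l *\<^sub>R e" and l: "l \<noteq> 0"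
    and g: "norm g = 1" "x *v g = m *\<^sub>R g" and m: "m \<noteq> 0"
    and eg: "inner e g = 0" "inner g (Q *v e) = 0"
  shows "2 * l\<^sup>2 + 2 * m\<^sup>2 \<le> inner x x"
proof -
  have Qe: "x *v (Q *v e) = - l *\<^sub>R (Q *v e)" and Qg: "x *v (Q *v g) = - m *\<^sub>R (Q *v g)"
    by (rule eigenvector_reflect; fact)+
  have n: "inner e e = 1" "inner (Q *v e) (Q *v e) = 1" "inner g g = 1" "inner (Q *v g) (Q *v g) = 1"
    using e g by (simp_all add: inner_involution norm_eq_1)
  have o: "inner e (Q *v e) = 0" "inner g (Q *v g) = 0"
    by (rule eigenvectors_orthogonal[OF e(2) Qe], use l in simp)
       (rule eigenvectors_orthogonal[OF g(2) Qg], use m in simp)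
  have o': "inner e (Q *v g) = 0" "inner (Q *v e) g = 0" "inner (Q *v e) (Q *v g) = 0"
    using eg inner_involution(1)[of e g] inner_commute[of g "Q *v e"] by (simp_all add: inner_involution(2))
  have ne: "e \<noteq> Q *v e" "e \<noteq> g" "e \<noteq> Q *v g" "Q *v e \<noteq> g" "Q *v e \<noteq> Q *v g" "g \<noteq> Q *v g"
    using n o o' eg by auto
  have "(\<Sum>s\<in>{e, Q *v e, g, Q *v g}. inner (x *v s) (x *v s)) \<le> inner x x"
    by (rule matrix_bessel)
       (use n o o' eg in \<open>auto simp: pairwise_def orthogonal_def inner_commute norm_eq_1\<close>)
  then show ?thesis using n ne by (simp add: e(2) g(2) Qe Qg power2_eq_square)
qed

lemma eigenvalue_gap_le:
  assumes y: "y \<in> odd_sym Q" and e: "norm e = 1" "x *v e = l *\<^sub>R e"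
    and f: "norm f = 1" "x *v f = m *\<^sub>R f" and nz: "inner e (y *v f) \<noteq> 0"
  shows "(l - m)\<^sup>2 \<le> inner x x"
proof -
  have sq: "(l - m)\<^sup>2 \<le> 2 * l\<^sup>2 + 2 * m\<^sup>2"
    using zero_le_power2[of "l + m"] by (simp add: power2_eq_square algebra_simps)
  have Qe: "x *v (Q *v e) = - l *\<^sub>R (Q *v e)" by (rule eigenvector_reflect[OF e(2)])
  consider "l = m" | "l \<noteq> m" "l = 0" | "l \<noteq> m" "m = 0" | "l \<noteq> m" "l \<noteq> 0" "m \<noteq> 0" "m \<noteq> - l" | "l \<noteq> 0" "m = - l"
    by blast
  then show ?thesis
  proof cases
    case 1 then show ?thesis by simp
  next
    case 2 then show ?thesis using eigenvalue_pair_le[OF f] by simp (smt (verit) zero_le_power2)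
  next
    case 3 then show ?thesis using eigenvalue_pair_le[OF e] by simp (smt (verit) zero_le_power2)
  next
    case 4
    have "inner e f = 0" by (rule eigenvectors_orthogonal[OF e(2) f(2) 4(1)])
    moreover have "inner f (Q *v e) = 0" by (rule eigenvectors_orthogonal[OF f(2) Qe 4(4)])
    ultimately show ?thesis using eigenvalue_quad_le[OF e 4(2) f 4(3)] sq by linarith
  next
    case 5
    have ef: "inner e f = 0" by (rule eigenvectors_orthogonal[OF e(2) f(2)]) (use 5 in simp)
    have eQe: "inner e (Q *v e) = 0" by (rule eigenvectors_orthogonal[OF e(2) Qe]) (use 5 in simp)
    have nQe: "inner (Q *v e) (Q *v e) = 1" using e by (simp add: inner_involution norm_eq_1)
    \<comment> \<open>When \<open>m = - l\<close>, the vectors \<open>f\<close> and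
      \<open>Q *v e\<close> share an eigenspace. Removing the common component gives a second
      eigenvector, provided it is nonzero.\<close>
    define h where "h = f - inner f (Q *v e) *\<^sub>R (Q *v e)"
    have "h \<noteq> 0"
    proof
      assume "h = 0"
      then have f_eq: "f = inner f (Q *v e) *\<^sub>R (Q *v e)" by (simp add: h_def)
      \<comment> \<open>The product of \<open>y\<close> and \<open>Q\<close> is skew, so its
        quadratic form vanishes. Thus \<open>f\<close> cannot be a multiple of \<open>Q *v e\<close>
        while being coupled to \<open>e\<close> by \<open>y\<close>.\<close>
      have "inner e (y *v (Q *v e)) = inner (Q *v (y *v e)) e"
        by (simp add: inner_matrix_vector_mult odd_symD(1)[OF y] GrassD[OF Q])
      also have "Q *v (y *v e) = - (y *v (Q *v e))"
        by (simp add: matrix_vector_mul_assoc odd_symD(3)[OF y])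
           (simp add: matrix_vector_mult_def vec_eq_iff sum_negf)
      finally have "inner e (y *v (Q *v e)) = 0" by (simp add: inner_commute)
      then have "inner e (y *v f) = 0"
        by (subst f_eq) (simp add: matrix_vector_mult_scaleR)
      with nz show False by simp
    qed
    define g where "g = (1 / norm h) *\<^sub>R h"
    have "norm g = 1" using \<open>h \<noteq> 0\<close> by (simp add: g_def)
    moreover have "x *v h = m *\<^sub>R h"
      using 5 f(2) Qe by (simp add: h_def matrix_vector_mult_diff_distrib matrix_vector_mult_scaleR scaleR_diff_right)
    then have "x *v g = m *\<^sub>R g" by (simp add: g_def matrix_vector_mult_scaleR)
    moreover have "inner e g = 0" "inner g (Q *v e) = 0"
      using ef eQe nQe by (simp_all add: g_def h_def inner_diff_left inner_diff_right)
    ultimately show ?thesis using eigenvalue_quad_le[OF e 5(1), of g m] 5 sq by simp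
  qed
qed

text \<open>In an eigenbasis of \<open>x\<close> the entries of the commutator are those of
  \<open>y\<close> scaled by eigenvalue gaps. Each nonzero entry is covered by
  \<open>eigenvalue_gap_le\<close>.\<close>

lemma comm_inner_le:
  assumes y: "y \<in> odd_sym Q"
  shows "inner (comm x y) (comm x y) \<le> inner x x * inner y y"
proof -
  obtain B where B: "onb UNIV B" and eig: "\<forall>b\<in>B. \<exists>l. x *v b = l *\<^sub>R b"
    using selfadjoint_eigenbasis[of "(*v) x" UNIV] inner_odd_selfadjoint by auto
  then obtain l where l: "\<And>b. b \<in> B \<Longrightarrow> x *v b = l b *\<^sub>R b" by metis
  have n: "norm b = 1" if "b \<in> B" for b using B that by (simp add: onb_def)
  have "(inner a (comm x y *v b))\<^sup>2 \<le> inner x x * (inner a (y *v b))\<^sup>2" if a: "a \<in> B" and b: "b \<in> B" for a b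
  proof -
    have "inner a (comm x y *v b) = inner (x *v a) (y *v b) - inner a (y *v (x *v b))"
      by (simp add: comm_def matrix_vector_mult_diff_rdistrib inner_diff_right inner_odd_selfadjoint
          flip: matrix_vector_mul_assoc)
    also have "\<dots> = (l a - l b) * inner a (y *v b)"
      by (simp add: l a b matrix_vector_mult_scaleR algebra_simps)
    finally have "(inner a (comm x y *v b))\<^sup>2 = (l a - l b)\<^sup>2 * (inner a (y *v b))\<^sup>2"
      by (simp add: power_mult_distrib)
    also have "\<dots> \<le> inner x x * (inner a (y *v b))\<^sup>2"
      using eigenvalue_gap_le[OF y n[OF a] l[OF a] n[OF b] l[OF b]]
      by (cases "inner a (y *v b) = 0") (auto intro: mult_right_mono)
    finally show ?thesis .
  qed
  then have "inner (comm x y) (comm x y) \<le> (\<Sum>b\<in>B. \<Sum>a\<in>B. inner x x * (inner a (y *v b))\<^sup>2)"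
    unfolding matrix_parseval[OF B, of "comm x y"] by (intro sum_mono)
  also have "\<dots> = inner x x * inner y y"
    unfolding matrix_parseval[OF B, of y] by (simp add: sum_distrib_left)
  finally show ?thesis .
qed

end

section \<open>Sectional curvatures of orthogonal planes\<close>

lemma comm_plane:
  "comm (a *\<^sub>R x + b *\<^sub>R y) (c *\<^sub>R x + d *\<^sub>R y) = (a * d - b * c) *\<^sub>R comm x y"
  by (simp add: comm_def mm_distribs algebra_simps)

lemma onb_pair:
  assumes "norm x = 1" "norm y = 1" "inner x y = 0"
  shows "onb (span {x, y}) {x, y}" "x \<noteq> y"
  using assms by (auto simp: onb_def span_base pairwise_insert orthogonal_def inner_commute)

text \<open>A change of basis in the plane multiplies the commutator by the determinant, which is 1
  or -1 between orthonormal bases. So the choice in \<open>sec_curv\<close> does not affect the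
  value.\<close>

lemma sec_curv_Grass:
  assumes Q: "Q \<in> Grass k" and x: "x \<in> odd_sym Q" "norm x = 1" and y: "y \<in> odd_sym Q" "norm y = 1"
    and xy: "inner x y = 0"
  shows "sec_curv (Grass k) Q (span {x, y}) = (1/4) * inner (comm x y) (comm x y)"
  unfolding sec_curv_def
proof (rule someI2_ex)
  show "\<exists>c x' y'. x' \<in> span {x, y} \<and> y' \<in> span {x, y} \<and> norm x' = 1 \<and> norm y' = 1 \<and>
      inner x' y' = 0 \<and> span {x', y'} = span {x, y} \<and> c = Rm (Grass k) Q x' y' y' x'"
    using x y xy by (blast intro: span_base)
next
  note B = onb_pair[OF x(2) y(2) xy]
  fix c assume "\<exists>x' y'. x' \<in> span {x, y} \<and> y' \<in> span {x, y} \<and> norm x' = 1 \<and> norm y' = 1 \<and>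
      inner x' y' = 0 \<and> span {x', y'} = span {x, y} \<and> c = Rm (Grass k) Q x' y' y' x'"
  then obtain x' y' where *: "x' \<in> span {x, y}" "y' \<in> span {x, y}" "norm x' = 1" "norm y' = 1"
      "inner x' y' = 0" "c = Rm (Grass k) Q x' y' y' x'" by blast
  have coord: "\<exists>a b. v = a *\<^sub>R x + b *\<^sub>R y" if "v \<in> span {x, y}" for v
  proof -
    have "v = inner v x *\<^sub>R x + inner v y *\<^sub>R y" using onb_expand[OF B(1) that] B(2) by simp
    then show ?thesis by blast
  qed
  obtain a b where x': "x' = a *\<^sub>R x + b *\<^sub>R y" using coord *(1) by blast
  obtain a' b' where y': "y' = a' *\<^sub>R x + b' *\<^sub>R y" using coord *(2) by blast
  have sub: "x' \<in> odd_sym Q" "y' \<in> odd_sym Q"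
    unfolding x' y' using x y subspace_odd_sym[of Q] by (auto intro!: subspace_add subspace_scale)
  have n: "inner x x = 1" "inner y y = 1" "inner y x = 0"
    using x y xy by (simp_all add: norm_eq_1 inner_commute)
  have "a * a + b * b = 1" "a' * a' + b' * b' = 1" "a * a' + b * b' = 0"
    using *(3-5) n xy unfolding x' y' norm_eq_1 by (simp_all add: inner_add mult.commute)
  \<comment> \<open>Lagrange's identity turns orthonormality of the coordinates into determinant
    squared equal to 1.\<close>
  moreover have "(a * b' - b * a')\<^sup>2 = (a * a + b * b) * (a' * a' + b' * b') - (a * a' + b * b')\<^sup>2"
    by (simp add: power2_eq_square algebra_simps)
  ultimately have "(a * b' - b * a')\<^sup>2 = 1" by simp
  then have "inner (comm x' y') (comm x' y') = inner (comm x y) (comm x y)"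
    unfolding x' y' comm_plane by (simp add: power2_eq_square flip: mult.assoc)
  then show "c = (1/4) * inner (comm x y) (comm x y)"
    unfolding *(6) using Rm_Grass_sectional[OF Q sub] by simp
qed

lemma sec_curv_Grass_bounds:
  assumes Q: "Q \<in> Grass k" and V: "subspace V" "V \<subseteq> odd_sym Q" "dim V = 2"
  shows "0 \<le> sec_curv (Grass k) Q V" "sec_curv (Grass k) Q V \<le> 1/4"
proof -
  obtain B where B: "B \<subseteq> V" "pairwise orthogonal B" "\<And>x. x \<in> B \<Longrightarrow> norm x = 1" "card B = 2" "span B = V"
    using orthonormal_basis_subspace[OF V(1)] V(3) by metis
  obtain x y where xy: "B = {x, y}" "x \<noteq> y" using B(4) by (auto simp: card_2_iff)
  have o: "norm x = 1" "norm y = 1" "inner x y = 0" "x \<in> odd_sym Q" "y \<in> odd_sym Q"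
    using B(1-3) xy V(2) by (auto simp: pairwise_insert orthogonal_def)
  have eq: "sec_curv (Grass k) Q V = (1/4) * inner (comm x y) (comm x y)"
    using sec_curv_Grass[OF Q o(4,1,5,2,3)] B(5) xy(1) by simp
  show "0 \<le> sec_curv (Grass k) Q V" unfolding eq by simp
  show "sec_curv (Grass k) Q V \<le> 1/4"
    unfolding eq using comm_inner_le[OF Q o(4,5)] o(1,2) by (simp add: norm_eq_1)
qed

lemma orth_planes_sum_bounds:
  assumes Q: "Q \<in> Grass k" and V: "orth_planes (Grass k) Q r V"
  shows "0 \<le> (\<Sum>j<r. sec_curv (Grass k) Q (V j))" "(\<Sum>j<r. sec_curv (Grass k) Q (V j)) \<le> real r / 4"
proof -
  have b: "0 \<le> sec_curv (Grass k) Q (V j)" "sec_curv (Grass k) Q (V j) \<le> 1/4" if "j < r" for j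
    using V that sec_curv_Grass_bounds[OF Q, of "V j"]
    by (auto simp: orth_planes_def tangent_space_Grass[OF Q])
  show "0 \<le> (\<Sum>j<r. sec_curv (Grass k) Q (V j))" using b by (intro sum_nonneg) auto
  have "(\<Sum>j<r. sec_curv (Grass k) Q (V j)) \<le> (\<Sum>j<r. 1/4)" using b by (intro sum_mono) auto
  then show "(\<Sum>j<r. sec_curv (Grass k) Q (V j)) \<le> real r / 4" by simp
qed

text \<open>Reduces both extremal constructions to an orthonormal family of 2r tangent vectors,
  paired with a prescribed squared commutator norm \<open>c\<close>.\<close>

lemma orth_planes_of_orthonormal:
  assumes Q: "Q \<in> Grass k"
    and odd: "\<And>i. i < r \<Longrightarrow> X i \<in> odd_sym Q" "\<And>i. i < r \<Longrightarrow> Y i \<in> odd_sym Q"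
    and XX: "\<And>i j. i < r \<Longrightarrow> j < r \<Longrightarrow> inner (X i) (X j) = (if i = j then 1 else 0)"
    and YY: "\<And>i j. i < r \<Longrightarrow> j < r \<Longrightarrow> inner (Y i) (Y j) = (if i = j then 1 else 0)"
    and XY: "\<And>i j. i < r \<Longrightarrow> j < r \<Longrightarrow> inner (X i) (Y j) = 0"
    and c: "\<And>i. i < r \<Longrightarrow> inner (comm (X i) (Y i)) (comm (X i) (Y i)) = c"
  shows "\<exists>V. orth_planes (Grass k) Q r V \<and> (\<Sum>j<r. sec_curv (Grass k) Q (V j)) = real r * c / 4"
proof (intro exI conjI)
  define V where "V i = span {X i, Y i}" for i
  have n: "norm (X i) = 1" "norm (Y i) = 1" if "i < r" for i
    using XX[OF that that] YY[OF that that] by (simp_all add: norm_eq_1)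
  show "orth_planes (Grass k) Q r V"
    unfolding orth_planes_def tangent_space_Grass[OF Q]
  proof (intro conjI allI impI ballI)
    fix j assume j: "j < r"
    show "subspace (V j)" by (simp add: V_def)
    show "V j \<subseteq> odd_sym Q"
      unfolding V_def by (rule span_minimal) (use odd j subspace_odd_sym in auto)
    note B = onb_pair[OF n[OF j] XY[OF j j]]
    have "independent {X j, Y j}"
      using B n[OF j] by (intro pairwise_orthogonal_independent) (auto simp: onb_def)
    then show "dim (V j) = 2" unfolding V_def dim_span using B(2) by (simp add: dim_eq_card_independent)
  next
    fix i j x y assume ij: "i < r" "j < r" "i \<noteq> j" and x: "x \<in> V i" and y: "y \<in> V j"
    have base: "orthogonal u v" if "u \<in> {X i, Y i}" "v \<in> {X j, Y j}" for u v
      using that XX[OF ij(1,2)] YY[OF ij(1,2)] XY[OF ij(1,2)] XY[OF ij(2,1)] ij(3)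
      by (auto simp: orthogonal_def inner_commute)
    have "orthogonal v x" if "v \<in> {X j, Y j}" for v
      using x base that unfolding V_def by (intro orthogonal_to_span[of x]) (auto simp: orthogonal_commute)
    then have "orthogonal x v" if "v \<in> {X j, Y j}" for v using that by (auto simp: orthogonal_commute)
    then show "orthogonal x y"
      using y unfolding V_def by (intro orthogonal_to_span[of y]) auto
  qed
  have "sec_curv (Grass k) Q (V j) = c / 4" if "j < r" for j
    unfolding V_def using sec_curv_Grass[OF Q odd(1)[OF that] n(1)[OF that] odd(2)[OF that] n(2)[OF that] XY[OF that that]]
      c[OF that] by simp
  then have "(\<Sum>j<r. sec_curv (Grass k) Q (V j)) = (\<Sum>j<r. c / 4)" by (intro sum.cong) auto
  then show "(\<Sum>j<r. sec_curv (Grass k) Q (V j)) = real r * c / 4" by simp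
qed

section \<open>Eigenbases of \<open>Q\<close> and an orthogonal grid of tangent vectors\<close>

lemma trace_onb:
  fixes A :: "real^'n^'n"
  assumes B: "onb UNIV B"
  shows "trace A = (\<Sum>b\<in>B. inner (A *v b) b)"
proof -
  have "trace A = (\<Sum>i\<in>UNIV. inner (A $ i) (axis i 1))"
    by (simp add: trace_def inner_axis)
  also have "\<dots> = (\<Sum>i\<in>UNIV. \<Sum>b\<in>B. (A *v b) $ i * b $ i)"
    by (rule sum.cong[OF refl], subst onb_inner[OF B UNIV_I])
       (simp add: matrix_vector_mul_component inner_axis')
  also have "\<dots> = (\<Sum>b\<in>B. inner (A *v b) b)"
    by (subst sum.swap) (simp add: inner_vec_def[of "A *v _"])
  finally show ?thesis .
qed

text \<open>Every w is half the sum of w + Qw and w - Qw, so bases of the two eigenspaces together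
  span. Their sizes add up to n and differ by tr Q = 2k - n.\<close>

lemma Grass_eigenbasis:
  fixes Q :: "real^'n^'n"
  assumes Q: "Q \<in> Grass k"
  obtains u v :: "nat \<Rightarrow> real^'n"
  where "\<And>i j. i < k \<Longrightarrow> j < k \<Longrightarrow> inner (u i) (u j) = (if i = j then 1 else 0)"
    and "\<And>i j. i < CARD('n) - k \<Longrightarrow> j < CARD('n) - k \<Longrightarrow> inner (v i) (v j) = (if i = j then 1 else 0)"
    and "\<And>i j. i < k \<Longrightarrow> j < CARD('n) - k \<Longrightarrow> inner (u i) (v j) = 0"
    and "\<And>i. i < k \<Longrightarrow> Q *v u i = u i" and "\<And>j. j < CARD('n) - k \<Longrightarrow> Q *v v j = - v j"
proof -
  let ?E = "{w. Q *v w = w}" and ?F = "{w. Q *v w = - w}"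
  have "subspace ?E" "subspace ?F"
    by (auto simp: subspace_def matrix_vector_right_distrib matrix_vector_mult_scaleR)
  from onb_exists[OF this(1)] onb_exists[OF this(2)]
  obtain A B where A: "onb ?E A" and B: "onb ?F B" by blast
  have QA: "Q *v a = a" if "a \<in> A" for a using that A by (auto simp: onb_def)
  have QB: "Q *v b = - b" if "b \<in> B" for b using that B by (auto simp: onb_def)
  have AB: "inner a b = 0" if "a \<in> A" "b \<in> B" for a b
    using inner_matrix_vector_mult[of Q a b] QA[OF that(1)] QB[OF that(2)] by (simp add: GrassD[OF Q])
  then have BA: "inner b a = 0" if "a \<in> A" "b \<in> B" for a b using that by (simp add: inner_commute)
  have nA: "inner a a = 1" if "a \<in> A" for a using onb_norm_inner[OF A that that] by simp
  have nB: "inner b b = 1" if "b \<in> B" for b using onb_norm_inner[OF B that that] by simp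
  have disj: "A \<inter> B = {}" using AB nA by force
  have U: "onb UNIV (A \<union> B)"
    unfolding onb_def
  proof (intro conjI)
    show "pairwise orthogonal (A \<union> B)"
      unfolding pairwise_def orthogonal_def
    proof (intro ballI impI)
      fix x y assume "x \<in> A \<union> B" "y \<in> A \<union> B" "x \<noteq> y"
      then show "inner x y = 0"
        using onb_norm_inner[OF A, of x y] onb_norm_inner[OF B, of x y] AB[of x y] BA[of y x] by auto
    qed
    show "\<forall>x\<in>A \<union> B. norm x = 1" using nA nB by (auto simp: norm_eq_1)
    have "w \<in> span (A \<union> B)" for w
    proof -
      have QQ: "Q *v (Q *v w) = w" by (simp add: matrix_vector_mul_assoc GrassD[OF Q])
      have "w + Q *v w \<in> span A" "w - Q *v w \<in> span B"
        using A B QQ by (auto simp: onb_def matrix_vector_right_distrib matrix_vector_mult_diff_distrib)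
      then have "w + Q *v w \<in> span (A \<union> B)" "w - Q *v w \<in> span (A \<union> B)"
        using span_mono[of A "A \<union> B"] span_mono[of B "A \<union> B"] by auto
      then have "(1/2) *\<^sub>R ((w + Q *v w) + (w - Q *v w)) \<in> span (A \<union> B)"
        by (rule span_scale[OF span_add])
      then show ?thesis by (simp flip: scaleR_2)
    qed
    then show "span (A \<union> B) = UNIV" by auto
  qed simp
  have fin: "finite A" "finite B" using onb_finite A B by auto
  have "trace Q = real (card A) - real (card B)"
    unfolding trace_onb[OF U] using fin disj by (simp add: sum.union_disjoint QA QB nA nB)
  moreover have "real CARD('n) = real (card A) + real (card B)"
    using trace_onb[OF U, of "mat 1"] fin disj by (simp add: trace_I sum.union_disjoint nA nB)
  ultimately have card: "card A = k" "card B = CARD('n) - k"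
    using GrassD(3)[OF Q] by linarith+
  obtain u where u: "bij_betw u {0..<k} A" using ex_bij_betw_nat_finite[OF fin(1)] card by auto
  obtain v where v: "bij_betw v {0..<CARD('n) - k} B" using ex_bij_betw_nat_finite[OF fin(2)] card by auto
  have uA: "u i \<in> A" if "i < k" for i using u that by (auto simp: bij_betw_def)
  have vB: "v i \<in> B" if "i < CARD('n) - k" for i using v that by (auto simp: bij_betw_def)
  show thesis
  proof (rule that)
    show "inner (u i) (u j) = (if i = j then 1 else 0)" if "i < k" "j < k" for i j
      using onb_norm_inner[OF A uA uA] that inj_onD[OF bij_betw_imp_inj_on[OF u], of i j] by auto
    show "inner (v i) (v j) = (if i = j then 1 else 0)" if "i < CARD('n) - k" "j < CARD('n) - k" for i j
      using onb_norm_inner[OF B vB vB] that inj_onD[OF bij_betw_imp_inj_on[OF v], of i j] by auto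
  qed (use uA vB AB QA QB in auto)
qed

definition outer :: "real^'n \<Rightarrow> real^'n \<Rightarrow> real^'n^'n" where
  "outer u v = (\<chi> i j. u $ i * v $ j)"

lemma outer_simps:
  fixes A :: "real^'n^'n"
  shows "transpose (outer u v) = outer v u" "A ** outer u v = outer (A *v u) v"
    "outer u v ** A = outer u (transpose A *v v)" "outer u v ** outer u' v' = inner v u' *\<^sub>R outer u v'"
    "outer (- u) v = - outer u v" "outer u (- v) = - outer u v"
  by (simp_all add: outer_def transpose_def matrix_matrix_mult_def matrix_vector_mult_def vec_eq_iff
      inner_vec_def sum_distrib_left sum_distrib_right mult_ac)

lemma inner_outer: "inner (outer u v) (outer u' v') = inner u u' * inner v v'"
  by (simp add: inner_matrix_eq_sum outer_def inner_vec_def sum_product mult_ac)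

text \<open>For unit vectors from opposite eigenspaces of \<open>Q\<close> this is an off-diagonal
  matrix unit plus its transpose, of squared norm 2.\<close>

definition sym_outer :: "real^'n \<Rightarrow> real^'n \<Rightarrow> real^'n^'n" where
  "sym_outer u v = outer u v + outer v u"

lemma sym_outer_odd:
  assumes "Q \<in> Grass k" "Q *v u = u" "Q *v v = - v"
  shows "sym_outer u v \<in> odd_sym Q"
  using assms GrassD(1)[OF assms(1)]
  by (simp add: sym_outer_def odd_sym_def transpose_linear mm_distribs outer_simps)

lemma inner_sym_outer:
  assumes "inner u v' = 0" "inner u' v = 0"
  shows "inner (sym_outer u v) (sym_outer u' v') = 2 * inner u u' * inner v v'"
  using assms by (simp add: sym_outer_def inner_add inner_outer inner_commute)

lemma comm_sym_outer:
  assumes "inner u v' = 0" "inner u' v = 0"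
  shows "comm (sym_outer u v) (sym_outer u' v')
    = inner v v' *\<^sub>R (outer u u' - outer u' u) + inner u u' *\<^sub>R (outer v v' - outer v' v)"
  using assms by (simp add: sym_outer_def comm_def mm_distribs outer_simps(4) inner_commute algebra_simps)

lemma comm_add_left: "comm (A + B) C = comm A C + comm B C"
  and comm_diff_right: "comm A (B - C) = comm A B - comm A C"
  and comm_scaleR_left: "comm (r *\<^sub>R A) B = r *\<^sub>R comm A B"
  and comm_scaleR_right: "comm A (r *\<^sub>R B) = r *\<^sub>R comm A B"
  by (simp_all add: comm_def mm_distribs algebra_simps)

text \<open>Position (a, b) of the off-diagonal block gives \<open>E a b\<close>. The last two facts
  provide the flat planes and the planes of maximal curvature; \<open>s\<close> is a sign.\<close>

lemma odd_sym_grid: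
  fixes Q :: "real^'n^'n"
  assumes Q: "Q \<in> Grass k"
  defines "m \<equiv> CARD('n) - k"
  obtains E :: "nat \<Rightarrow> nat \<Rightarrow> real^'n^'n"
  where "\<And>a b. a < k \<Longrightarrow> b < m \<Longrightarrow> E a b \<in> odd_sym Q"
    and "\<And>a b c d. a < k \<Longrightarrow> b < m \<Longrightarrow> c < k \<Longrightarrow> d < m \<Longrightarrow>
      inner (E a b) (E c d) = (if a = c \<and> b = d then 2 else 0)"
    and "\<And>a b c d. a < k \<Longrightarrow> b < m \<Longrightarrow> c < k \<Longrightarrow> d < m \<Longrightarrow> a \<noteq> c \<Longrightarrow> b \<noteq> d \<Longrightarrow> comm (E a b) (E c d) = 0"
    and "\<And>a b c d s. a < k \<Longrightarrow> b < m \<Longrightarrow> c < k \<Longrightarrow> d < m \<Longrightarrow> a \<noteq> c \<Longrightarrow> b \<noteq> d \<Longrightarrow> s * s = 1 \<Longrightarrow>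
      inner (comm (E a b + s *\<^sub>R E c d) (E a d - s *\<^sub>R E c b)) (comm (E a b + s *\<^sub>R E c d) (E a d - s *\<^sub>R E c b)) = 16"
proof -
  obtain u v :: "nat \<Rightarrow> real^'n" where uu: "\<And>i j. i < k \<Longrightarrow> j < k \<Longrightarrow> inner (u i) (u j) = (if i = j then 1 else 0)"
    and vv: "\<And>i j. i < m \<Longrightarrow> j < m \<Longrightarrow> inner (v i) (v j) = (if i = j then 1 else 0)"
    and uv: "\<And>i j. i < k \<Longrightarrow> j < m \<Longrightarrow> inner (u i) (v j) = 0"
    and Qu: "\<And>i. i < k \<Longrightarrow> Q *v u i = u i" and Qv: "\<And>j. j < m \<Longrightarrow> Q *v v j = - v j"
    unfolding m_def by (rule Grass_eigenbasis[OF Q]) blast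
  define E where "E a b = sym_outer (u a) (v b)" for a b
  have comm_E: "comm (E a b) (E c d) = (if b = d then outer (u a) (u c) - outer (u c) (u a) else 0)
      + (if a = c then outer (v b) (v d) - outer (v d) (v b) else 0)"
    if "a < k" "b < m" "c < k" "d < m" for a b c d
    using that by (simp add: E_def comm_sym_outer uu vv uv)
  show thesis
  proof (rule that)
    show "E a b \<in> odd_sym Q" if "a < k" "b < m" for a b
      unfolding E_def by (rule sym_outer_odd[OF Q Qu Qv]) (use that in auto)
    show "inner (E a b) (E c d) = (if a = c \<and> b = d then 2 else 0)"
      if "a < k" "b < m" "c < k" "d < m" for a b c d
      using that by (simp add: E_def inner_sym_outer uu vv uv)
    show "comm (E a b) (E c d) = 0" if "a < k" "b < m" "c < k" "d < m" "a \<noteq> c" "b \<noteq> d" for a b c d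
      using that by (simp add: comm_E)
    show "inner (comm (E a b + s *\<^sub>R E c d) (E a d - s *\<^sub>R E c b)) (comm (E a b + s *\<^sub>R E c d) (E a d - s *\<^sub>R E c b)) = 16"
      if h: "a < k" "b < m" "c < k" "d < m" "a \<noteq> c" "b \<noteq> d" and s: "s * s = 1" for a b c d and s :: real
    proof -
      define U where "U = outer (u a) (u c) - outer (u c) (u a)"
      define W where "W = outer (v b) (v d) - outer (v d) (v b)"
      have "comm (E a b + s *\<^sub>R E c d) (E a d - s *\<^sub>R E c b)
          = comm (E a b) (E a d) - s *\<^sub>R comm (E a b) (E c b) + s *\<^sub>R comm (E c d) (E a d)
            - (s * s) *\<^sub>R comm (E c d) (E c b)"
        by (simp add: comm_add_left comm_diff_right comm_scaleR_left comm_scaleR_right algebra_simps)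
      \<comment> \<open>Two commutators contribute \<open>W\<close> and two contribute
        \<open>U\<close>. As these are orthogonal of squared norm 2, the final squared norm is 4(2 +
        2) = 16.\<close>
      also have "\<dots> = 2 *\<^sub>R (W - s *\<^sub>R U)"
      proof -
        have "comm (E a b) (E a d) = W" "comm (E a b) (E c b) = U" "comm (E c d) (E a d) = - U"
          "comm (E c d) (E c b) = - W"
          using h by (simp_all add: comm_E U_def W_def)
        then show ?thesis by (simp add: s vec_eq_iff algebra_simps)
      qed
      finally have C: "comm (E a b + s *\<^sub>R E c d) (E a d - s *\<^sub>R E c b) = 2 *\<^sub>R (W - s *\<^sub>R U)" .
      have "inner U U = 2" "inner W W = 2" "inner W U = 0" "inner U W = 0"
        using h uv by (simp_all add: U_def W_def inner_diff inner_outer uu vv uv inner_commute[of "v _" "u _"])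
      then show ?thesis unfolding C using s by (simp add: inner_diff)
    qed
  qed
qed

lemma grid_index_inj:
  fixes i j M :: nat
  assumes "even i = even j" "(i div 2) mod M = (j div 2) mod M" "(i div 2) div M = (j div 2) div M"
  shows "i = j"
proof -
  have "i div 2 = j div 2" using assms(2,3) by (metis div_mult_mod_eq)
  moreover have "i mod 2 = j mod 2" using assms(1) by presburger
  ultimately show ?thesis by (metis div_mult_mod_eq)
qed

lemma curvature_sums_attained:
  fixes Q :: "real^'n^'n"
  assumes Q: "Q \<in> Grass k" and r: "r \<le> 2 * (k div 2) * ((CARD('n) - k) div 2)"
  shows "\<exists>V. orth_planes (Grass k) Q r V \<and> (\<Sum>j<r. sec_curv (Grass k) Q (V j)) = 0"
    and "\<exists>V. orth_planes (Grass k) Q r V \<and> (\<Sum>j<r. sec_curv (Grass k) Q (V j)) = real r / 4"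
proof -
  define m where "m = CARD('n) - k"
  obtain E :: "nat \<Rightarrow> nat \<Rightarrow> real^'n^'n" where E: "\<And>a b. a < k \<Longrightarrow> b < m \<Longrightarrow> E a b \<in> odd_sym Q"
    and EE: "\<And>a b c d. a < k \<Longrightarrow> b < m \<Longrightarrow> c < k \<Longrightarrow> d < m \<Longrightarrow>
      inner (E a b) (E c d) = (if a = c \<and> b = d then 2 else 0)"
    and E0: "\<And>a b c d. a < k \<Longrightarrow> b < m \<Longrightarrow> c < k \<Longrightarrow> d < m \<Longrightarrow> a \<noteq> c \<Longrightarrow> b \<noteq> d \<Longrightarrow> comm (E a b) (E c d) = 0"
    and E16: "\<And>a b c d s. a < k \<Longrightarrow> b < m \<Longrightarrow> c < k \<Longrightarrow> d < m \<Longrightarrow> a \<noteq> c \<Longrightarrow> b \<noteq> d \<Longrightarrow> s * s = 1 \<Longrightarrow>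
      inner (comm (E a b + s *\<^sub>R E c d) (E a d - s *\<^sub>R E c b)) (comm (E a b + s *\<^sub>R E c d) (E a d - s *\<^sub>R E c b)) = 16"
    unfolding m_def by (rule odd_sym_grid[OF Q]) blast
  \<comment> \<open>The quotient \<open>j div 2\<close> numbers the 2 by 2 blocks with corner
    \<open>(p j, q j)\<close>, and the parity of \<open>j\<close> selects one of two planes in the
    block. The bound on \<open>r\<close> keeps the corners inside the grid.\<close>
  define p where "p j = 2 * ((j div 2) mod (k div 2))" for j
  define q where "q j = 2 * ((j div 2) div (k div 2))" for j
  have pq: "p j < k" "Suc (p j) < k" "q j < m" "Suc (q j) < m" if "j < r" for j
  proof -
    have lt: "j < 2 * ((m div 2) * (k div 2))" using that r by (simp add: m_def mult_ac)
    then have "k div 2 > 0" by (cases "k div 2 = 0") auto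
    then have "(j div 2) mod (k div 2) < k div 2" by simp
    moreover have "j div 2 < (m div 2) * (k div 2)" using lt by linarith
    then have "(j div 2) div (k div 2) < m div 2" by (rule less_mult_imp_div_less)
    ultimately show "p j < k" "Suc (p j) < k" "q j < m" "Suc (q j) < m"
      unfolding p_def q_def by linarith+
  qed
  have inj: "i = j" if "even i = even j" "p i = p j" "q i = q j" for i j
    using grid_index_inj[of i j "k div 2"] that by (simp add: p_def q_def)
  have parity: "p i \<noteq> Suc (p j)" "Suc (p i) \<noteq> p j" "q i \<noteq> Suc (q j)" "Suc (q i) \<noteq> q j" for i j
  proof -
    have "2 * x \<noteq> Suc (2 * y)" for x y :: nat by presburger
    then show "p i \<noteq> Suc (p j)" "Suc (p i) \<noteq> p j" "q i \<noteq> Suc (q j)" "Suc (q i) \<noteq> q j"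
      unfolding p_def q_def by (metis)+
  qed
  \<comment> \<open>The two planes of one block carry opposite signs, so the inner product of their
    first vectors is proportional to 1 + s s' = 0; the second vectors behave alike.\<close>
  define s :: "nat \<Rightarrow> real" where "s j = (if even j then 1 else - 1)" for j
  have ss: "s i * s j = (if even i = even j then 1 else - 1)" for i j by (simp add: s_def)
  \<comment> \<open>The sum of two orthogonal grid vectors has norm 2, hence the factor 1/2. The
    squared commutator norm becomes 16/16 = 1.\<close>
  define X where "X j = (1/2) *\<^sub>R (E (p j) (q j) + s j *\<^sub>R E (Suc (p j)) (Suc (q j)))" for j
  define Y where "Y j = (1/2) *\<^sub>R (E (p j) (Suc (q j)) - s j *\<^sub>R E (Suc (p j)) (q j))" for j
  have "\<exists>V. orth_planes (Grass k) Q r V \<and> (\<Sum>j<r. sec_curv (Grass k) Q (V j)) = real r * 1 / 4"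
  proof (rule orth_planes_of_orthonormal[OF Q])
    show "X i \<in> odd_sym Q" "Y i \<in> odd_sym Q" if "i < r" for i
      unfolding X_def Y_def using pq[OF that] E subspace_odd_sym[of Q]
      by (auto intro!: subspace_scale subspace_add subspace_diff)
    show "inner (X i) (X j) = (if i = j then 1 else 0)" if "i < r" "j < r" for i j
      using pq[OF that(1)] pq[OF that(2)] inj[of i j] parity[of i j] ss[of i j] ss[of j i]
      by (auto simp: X_def inner_add EE)
    show "inner (Y i) (Y j) = (if i = j then 1 else 0)" if "i < r" "j < r" for i j
      using pq[OF that(1)] pq[OF that(2)] inj[of i j] parity[of i j] ss[of i j] ss[of j i]
      by (auto simp: Y_def inner_diff EE)
    show "inner (X i) (Y j) = 0" if "i < r" "j < r" for i j
      using pq[OF that(1)] pq[OF that(2)] parity[of i j]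
      by (auto simp: X_def Y_def inner_add inner_diff EE)
    show "inner (comm (X i) (Y i)) (comm (X i) (Y i)) = 1" if "i < r" for i
      using E16[of "p i" "q i" "Suc (p i)" "Suc (q i)" "s i"] pq[OF that] ss[of i i]
      by (simp add: X_def Y_def comm_scaleR_left comm_scaleR_right)
  qed
  then show "\<exists>V. orth_planes (Grass k) Q r V \<and> (\<Sum>j<r. sec_curv (Grass k) Q (V j)) = real r / 4" by simp
  \<comment> \<open>Each flat plane is spanned by diagonally opposite corners of a block, which
    commute; parity selects the diagonal.\<close>
  define X0 where "X0 j = (1 / sqrt 2) *\<^sub>R E (p j) (if even j then q j else Suc (q j))" for j
  define Y0 where "Y0 j = (1 / sqrt 2) *\<^sub>R E (Suc (p j)) (if even j then Suc (q j) else q j)" for j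
  have "\<exists>V. orth_planes (Grass k) Q r V \<and> (\<Sum>j<r. sec_curv (Grass k) Q (V j)) = real r * 0 / 4"
  proof (rule orth_planes_of_orthonormal[OF Q])
    show "X0 i \<in> odd_sym Q" "Y0 i \<in> odd_sym Q" if "i < r" for i
      unfolding X0_def Y0_def using pq[OF that] E subspace_odd_sym[of Q]
      by (auto intro!: subspace_scale)
    show "inner (X0 i) (X0 j) = (if i = j then 1 else 0)" if "i < r" "j < r" for i j
      using pq[OF that(1)] pq[OF that(2)] inj[of i j] parity[of i j]
      by (auto simp: X0_def EE)
    show "inner (Y0 i) (Y0 j) = (if i = j then 1 else 0)" if "i < r" "j < r" for i j
      using pq[OF that(1)] pq[OF that(2)] inj[of i j] parity[of i j]
      by (auto simp: Y0_def EE)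
    show "inner (X0 i) (Y0 j) = 0" if "i < r" "j < r" for i j
      using pq[OF that(1)] pq[OF that(2)] parity[of i j]
      by (auto simp: X0_def Y0_def EE)
    show "inner (comm (X0 i) (Y0 i)) (comm (X0 i) (Y0 i)) = 0" if "i < r" for i
      using pq[OF that] by (simp add: X0_def Y0_def comm_scaleR_left comm_scaleR_right E0)
  qed
  then show "\<exists>V. orth_planes (Grass k) Q r V \<and> (\<Sum>j<r. sec_curv (Grass k) Q (V j)) = 0" by simp
qed

theorem mainTheorem10:
  fixes Q :: "real^'n^'n" and k r :: nat
  assumes "1 \<le> k" and "k \<le> CARD('n) - 1"
    and "0 < r" and "r \<le> 2 * (k div 2) * ((CARD('n) - k) div 2)"
    and "Q \<in> Grass k"
  shows "delta_upper (Grass k) Q r = real k * (real CARD('n) - real k) * (real CARD('n) - 2) / 8 \<and>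
         delta_lower (Grass k) Q r = real k * (real CARD('n) - real k) * (real CARD('n) - 2) / 8 - real r / 4"
proof -
  note Q = \<open>Q \<in> Grass k\<close>
  let ?S = "{(\<Sum>j<r. sec_curv (Grass k) Q (V j)) | V. orth_planes (Grass k) Q r V}"
  \<comment> \<open>Both bounds on the curvature sums are attained, so infimum and supremum are a
    minimum and a maximum.\<close>
  have mem: "0 \<in> ?S" "real r / 4 \<in> ?S"
    using curvature_sums_attained[OF Q assms(4)] by force+
  have bounds: "0 \<le> c" "c \<le> real r / 4" if "c \<in> ?S" for c
    using that orth_planes_sum_bounds[OF Q] by blast+
  have "Inf ?S = 0" by (rule cInf_eq_minimum[OF mem(1) bounds(1)])
  moreover have "Sup ?S = real r / 4" by (rule cSup_eq_maximum[OF mem(2) bounds(2)])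
  ultimately show ?thesis
    by (simp add: delta_upper_def delta_lower_def Scal_Grass[OF Q])
qed

end
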